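(* Let $\mu\in\mathcal{U}$ and let $k=k(\mu)$. Let $\sigma>0$, $\xi\sim\mathcal{N}(0,\sigma^2I_{n\times n})$ and $y=\mu+\xi$. Then for all $x>0$, $$\|\hat\mu^{LS}(\mathcal{U})-\mu\|\le\frac{2\sigma}{\sqrt n}\left(\sqrt{(k+1)\log\left(\tfrac{en}{k+1}\right)}+\sqrt{2(x+\log n)}\right)$$ holds with probability at least $1-e^{-x}$.
   Context: Scaled norm: $\|v\|^2=\frac1n\sum_{i=1}^n v_i^2$ for $v\in\mathbb{R}^n$. $\mathcal{U}=\bigcup_{m=1}^nK_m$ is the set of unimodal sequences in $\mathbb{R}^n$, where $K_m=\{u\in\mathbb{R}^n: u_1\ge\dots\ge u_m\le u_{m+1}\le\dots\le u_n\}$. For $u\in\mathcal{U}$, $k(u)$ is the smallest integer $k$ such that there is a partition of $\{1,\dots,n\}$ into $k$ sets of consecutive integers on each of which $u$ is constant. The least squares estimator over a nonempty closed (possibly non-convex) set $K$ is any $\hat\mu^{LS}(K)\in\operatorname{argmin}_{v\in K}\|y-v\|^2$. *)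

theory Defs
  imports "HOL-Probability.Probability" "HOL-Library.Disjoint_Sets"
begin

text \<open>A vector of \<open>\<real>\<close>-entries indexed by \<open>1, \<dots>, n\<close> is a function \<^typ>\<open>nat \<Rightarrow> real\<close> of which only
  the values on \<open>{1..n}\<close> are relevant; every notion below depends on these values only.\<close>

definition scaled_norm :: "nat \<Rightarrow> (nat \<Rightarrow> real) \<Rightarrow> real" where
  "scaled_norm n v = sqrt ((1 / real n) * (\<Sum>i=1..n. (v i)\<^sup>2))"

definition unimodal_cone :: "nat \<Rightarrow> nat \<Rightarrow> (nat \<Rightarrow> real) set" where
  "unimodal_cone n m =
     {u. (\<forall>i\<in>{1..<m}. u i \<ge> u (i + 1)) \<and> (\<forall>i\<in>{m..<n}. u i \<le> u (i + 1))}"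

definition unimodal :: "nat \<Rightarrow> (nat \<Rightarrow> real) set" where
  "unimodal n = (\<Union>m\<in>{1..n}. unimodal_cone n m)"

definition num_pieces :: "nat \<Rightarrow> (nat \<Rightarrow> real) \<Rightarrow> nat" where
  "num_pieces n u =
     (LEAST k. \<exists>P. partition_on {1..n} P \<and> card P = k \<and>
        (\<forall>I\<in>P. (\<exists>a b. I = {a..b}) \<and> (\<forall>i\<in>I. \<forall>j\<in>I. u i = u j)))"

definition is_least_squares :: "nat \<Rightarrow> (nat \<Rightarrow> real) set \<Rightarrow> (nat \<Rightarrow> real) \<Rightarrow> (nat \<Rightarrow> real) \<Rightarrow> bool" where
  "is_least_squares n K y v \<longleftrightarrow>
     is_arg_min (\<lambda>w. (scaled_norm n (\<lambda>i. y i - w i))\<^sup>2) (\<lambda>w. w \<in> K) v"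

text \<open>An arbitrary choice of a (possibly non-unique) minimiser need not be measurable, so
  ``with probability at least \<open>p\<close>'' is expressed by an event of probability at least \<open>p\<close> on which
  the property holds. For measurable properties this is the usual meaning, as shown below.\<close>

definition holds_with_prob_ge :: "'a measure \<Rightarrow> real \<Rightarrow> ('a \<Rightarrow> bool) \<Rightarrow> bool" where
  "holds_with_prob_ge M p Q \<longleftrightarrow> (\<exists>A\<in>sets M. measure M A \<ge> p \<and> (\<forall>\<omega>\<in>A. Q \<omega>))"

lemma holds_with_prob_ge_measurable:
  assumes "prob_space M" and "{\<omega> \<in> space M. Q \<omega>} \<in> sets M"
  shows "holds_with_prob_ge M p Q \<longleftrightarrow> measure M {\<omega> \<in> space M. Q \<omega>} \<ge> p"
proof
  interpret prob_space M by fact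
  assume "holds_with_prob_ge M p Q"
  then obtain A where A: "A \<in> sets M" "measure M A \<ge> p" "\<forall>\<omega>\<in>A. Q \<omega>"
    unfolding holds_with_prob_ge_def by blast
  have "A \<subseteq> {\<omega> \<in> space M. Q \<omega>}"
    using A(1,3) sets.sets_into_space by blast
  then have "measure M A \<le> measure M {\<omega> \<in> space M. Q \<omega>}"
    using assms(2) by (rule finite_measure_mono)
  with A(2) show "measure M {\<omega> \<in> space M. Q \<omega>} \<ge> p" by linarith
next
  assume "measure M {\<omega> \<in> space M. Q \<omega>} \<ge> p"
  with assms(2) show "holds_with_prob_ge M p Q"
    unfolding holds_with_prob_ge_def by blast
qed

end

theory Submission
  imports Defs "HOL-Combinatorics.Multiset_Permutations"
begin

text \<open>
  Let \<open>h\<close> be the error of the estimator. Minimality gives \<open>\<Sum>h\<^sup>2 \<le> 2 \<Sum>\<xi> h\<close>. If the mode of the estimator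
  is \<open>m\<close>, then \<open>h\<close> is monotone on each of at most \<open>k + 1\<close> intervals, namely the pieces of \<open>\<mu>\<close> with the piece
  containing \<open>m\<close> cut at \<open>m\<close>. So it suffices to bound, for each of the \<open>n\<close> values of \<open>m\<close>, the squared norm
  of the projection of \<open>\<xi>\<close> onto a product of monotone cones.

  For one monotone cone in dimension \<open>j\<close>, the exponential moment of this squared norm is computed by
  a Sparre Andersen type argument. The projection averages over the faces of the greatest convex
  minorant of the random walk with increments \<open>\<xi>\<close>. Removing the face that contains a given increment
  maps the orderings of the increments injectively to pairs of a cyclic arrangement of the removed face and
  an ordering of the rest: the rotation of the face and the place of its insertion
  can be recovered. Averaging over all orderings gives the recursion
  \<open>j F\<^sub>j \<le> s (F\<^sub>0 + \<dots> + F\<^sub>j\<^sub>-\<^sub>1)\<close>, where \<open>s\<close> is the exponential moment of the square of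
  one normal variable. Hence \<open>F\<^sub>j \<le> (\<Prod>i\<le>j. 1 + (s - 1) / i) \<le> exp ((s - 1) (1 + ln j))\<close>. With \<open>a\<close> the sum of the
  \<open>1 + ln j\<close> over the intervals, Markov's inequality at \<open>s = 1 + t / sqrt a\<close> yields exactly the Gaussian
  tail \<open>exp (- t\<^sup>2 / 2)\<close> above \<open>\<sigma> (sqrt a + t)\<close>.
\<close>

section \<open>Faces of the greatest convex minorant\<close>

text \<open>The rise, relative to a line of slope \<open>c\<close>, of the walk that takes the steps
  \<open>x\<close> along \<open>l\<close>.\<close>

definition dev :: "('i \<Rightarrow> real) \<Rightarrow> real \<Rightarrow> 'i list \<Rightarrow> real" where
  "dev x c l = (\<Sum>i\<leftarrow>l. x i - c)"

definition avg :: "('i \<Rightarrow> real) \<Rightarrow> 'i list \<Rightarrow> real" where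
  "avg x l = (\<Sum>i\<leftarrow>l. x i) / real (length l)"

text \<open>The walk along \<open>b\<close> stays strictly above its chord at all interior times, so
  its greatest convex minorant is the chord alone and \<open>b\<close> is a single face.\<close>

definition irreducible_block :: "('i \<Rightarrow> real) \<Rightarrow> 'i list \<Rightarrow> bool" where
  "irreducible_block x b \<longleftrightarrow>
     b \<noteq> [] \<and> (\<forall>u v. b = u @ v \<longrightarrow> u \<noteq> [] \<longrightarrow> v \<noteq> [] \<longrightarrow> avg x v < avg x u)"

text \<open>Excludes adjacent faces of equal slope. Normal increments satisfy this almost
  surely.\<close>

definition generic_on :: "('i \<Rightarrow> real) \<Rightarrow> 'i set \<Rightarrow> bool" where
  "generic_on x X \<longleftrightarrow>
     (\<forall>u v. u \<noteq> [] \<longrightarrow> v \<noteq> [] \<longrightarrow> distinct (u @ v) \<longrightarrow> set (u @ v) \<subseteq> X \<longrightarrow> avg x u \<noteq> avg x v)"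

lemma dev_Nil [simp]: "dev x c [] = 0"
  and dev_append [simp]: "dev x c (u @ v) = dev x c u + dev x c v"
  and dev_Cons [simp]: "dev x c (i # v) = x i - c + dev x c v"
  by (simp_all add: dev_def)

lemma dev_eq: "dev x c l = real (length l) * (avg x l - c)"
proof -
  have "dev x c l = (\<Sum>i\<leftarrow>l. x i) - real (length l) * c"
    by (induction l) (simp_all add: algebra_simps)
  then show ?thesis
    by (cases "l = []") (simp_all add: avg_def right_diff_distrib)
qed

lemma dev_sign:
  assumes "l \<noteq> []"
  shows "dev x c l < 0 \<longleftrightarrow> avg x l < c" "dev x c l > 0 \<longleftrightarrow> c < avg x l"
    "dev x c l = 0 \<longleftrightarrow> avg x l = c"
  using assms by (auto simp: dev_eq zero_less_mult_iff mult_less_0_iff)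

text \<open>The deviations of \<open>u\<close> and \<open>v\<close> from their joint average add up
  to 0, so the sign of either one tells which list has the larger average.\<close>

lemma dev_less_iff_avg: "avg x v < avg x u \<longleftrightarrow> dev x (avg x (u @ v)) v < 0" (is ?A)
  and dev_greater_iff_avg: "avg x v < avg x u \<longleftrightarrow> dev x (avg x (u @ v)) u > 0" (is ?B)
  if "u \<noteq> []" "v \<noteq> []"
proof -
  let ?c = "avg x (u @ v)"
  have sum0: "dev x ?c u + dev x ?c v = 0"
    using dev_sign(3)[of "u @ v" x ?c] that by simp
  have "avg x v < avg x u" if "dev x ?c v < 0"
    using that sum0 dev_sign[of u x ?c] dev_sign[of v x ?c] \<open>u \<noteq> []\<close> \<open>v \<noteq> []\<close> by linarith
  moreover have "\<not> avg x v < avg x u" if "dev x ?c v \<ge> 0"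
    using that sum0 dev_sign[of u x ?c] dev_sign[of v x ?c] \<open>u \<noteq> []\<close> \<open>v \<noteq> []\<close> by linarith
  ultimately show ?A by force
  with sum0 show ?B by linarith
qed

lemma irreducible_block_prefix:
  assumes "irreducible_block x (u @ v)" "u \<noteq> []" "v \<noteq> []"
  shows "dev x (avg x (u @ v)) u > 0"
  using assms dev_greater_iff_avg[of u v x] by (auto simp: irreducible_block_def)

lemma irreducible_block_suffix:
  assumes "irreducible_block x (u @ v)" "u \<noteq> []" "v \<noteq> []"
  shows "dev x (avg x (u @ v)) v < 0"
  using assms dev_less_iff_avg[of u v x] by (auto simp: irreducible_block_def)

lemma dev_antimono: "c \<le> d \<Longrightarrow> dev x d l \<le> dev x c l"
  unfolding dev_eq by (intro mult_left_mono) auto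

text \<open>The joint average lies strictly between the two averages. A prefix ending inside
  \<open>b\<close> lies above the chord of \<open>b\<close>, and lowering the slope to the joint
  average only raises it further; suffixes starting inside \<open>c\<close> are treated
  dually.\<close>

lemma irreducible_block_merge:
  assumes b: "irreducible_block x b" and c: "irreducible_block x c" and less: "avg x c < avg x b"
  shows "irreducible_block x (b @ c)"
  unfolding irreducible_block_def
proof (intro conjI allI impI)
  show "b @ c \<noteq> []" using b by (simp add: irreducible_block_def)
  fix u v assume eq: "b @ c = u @ v" and ne: "u \<noteq> []" "v \<noteq> []"
  have bne: "b \<noteq> []" "c \<noteq> []" using b c by (auto simp: irreducible_block_def)
  let ?m = "avg x (b @ c)"
  have mb: "dev x ?m b > 0" and mc: "dev x ?m c < 0"
    using dev_less_iff_avg dev_greater_iff_avg bne less by blast+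
  then have m: "?m < avg x b" "avg x c < ?m"
    using dev_sign bne by blast+
  from eq consider t where "b = u @ t" "v = t @ c" | t where "u = b @ t" "c = t @ v"
    by (auto simp: append_eq_append_conv2)
  then have "dev x ?m u > 0 \<or> dev x ?m v < 0"
  proof cases
    case 1
    show ?thesis
    proof (cases "t = []")
      case False
      have "dev x (avg x b) u > 0"
        using irreducible_block_prefix[of x u t] b 1 ne False by simp
      then show ?thesis using dev_antimono[of ?m "avg x b" x u] m by linarith
    qed (use mb 1 in simp)
  next
    case 2
    show ?thesis
    proof (cases "t = []")
      case False
      have "dev x (avg x c) v < 0"
        using irreducible_block_suffix[of x t v] c 2 ne False by simp
      then show ?thesis using dev_antimono[of "avg x c" ?m x v] m by linarith
    qed (use mc 2 in simp)
  qed
  then show "avg x v < avg x u"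
    using dev_less_iff_avg[OF ne] dev_greater_iff_avg[OF ne] eq by metis
qed

section \<open>Existence of the decomposition into faces of increasing slope\<close>

definition block_decomposition :: "('i \<Rightarrow> real) \<Rightarrow> 'i list list \<Rightarrow> bool" where
  "block_decomposition x bs \<longleftrightarrow>
     (\<forall>b\<in>set bs. irreducible_block x b) \<and> sorted_wrt (\<lambda>b c. avg x b < avg x c) bs"

text \<open>This is the pool-adjacent-violators step: a new first block is merged with its successor
  for as long as its average is the larger one. Genericity rules out ties.\<close>

lemma block_decomposition_insert:
  assumes "generic_on x X" "distinct (b @ concat bs)" "set (b @ concat bs) \<subseteq> X"
    "irreducible_block x b" "block_decomposition x bs"
  shows "\<exists>bs'. concat bs' = b @ concat bs \<and> block_decomposition x bs'"
  using assms
proof (induction bs arbitrary: b)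
  case Nil
  then show ?case by (intro exI[of _ "[b]"]) (simp add: block_decomposition_def)
next
  case (Cons c bs)
  have irr: "irreducible_block x c" using Cons.prems by (simp add: block_decomposition_def)
  have "avg x b \<noteq> avg x c"
  proof -
    have "b \<noteq> []" "c \<noteq> []" "distinct (b @ c)" "set (b @ c) \<subseteq> X"
      using Cons.prems(2-4) irr by (auto simp: irreducible_block_def)
    with Cons.prems(1) show ?thesis unfolding generic_on_def by blast
  qed
  then consider "avg x b < avg x c" | "avg x c < avg x b" by linarith
  then show ?case
  proof cases
    case 1
    then have "block_decomposition x (b # c # bs)"
      using Cons.prems by (force simp: block_decomposition_def)
    then show ?thesis by (intro exI[of _ "b # c # bs"]) simp
  next
    case 2
    have "irreducible_block x (b @ c)" using irreducible_block_merge Cons.prems irr 2 by blast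
    with Cons.IH[of "b @ c"] Cons.prems show ?thesis
      by (auto simp: block_decomposition_def)
  qed
qed

lemma block_decomposition_exists:
  assumes "generic_on x X" "distinct l" "set l \<subseteq> X"
  shows "\<exists>bs. concat bs = l \<and> block_decomposition x bs"
  using assms
proof (induction l)
  case Nil
  then show ?case by (intro exI[of _ "[]"]) (simp add: block_decomposition_def)
next
  case (Cons a l)
  then obtain bs where bs: "concat bs = l" "block_decomposition x bs" by auto
  have "irreducible_block x [a]" by (auto simp: irreducible_block_def Cons_eq_append_conv)
  with block_decomposition_insert[of x X "[a]" bs] Cons.prems bs show ?case by auto
qed

text \<open>A suffix consists of a suffix of one block followed by whole blocks, and each nonempty
  part has average below \<open>c\<close>. The weak inequality is carried along so that possibly
  empty parts can be added in the induction.\<close>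

lemma suffix_below_blocks:
  assumes "\<forall>b\<in>set bs. irreducible_block x b \<and> avg x b < c" "concat bs = u @ v"
  shows "dev x c v \<le> 0 \<and> (v \<noteq> [] \<longrightarrow> dev x c v < 0)"
  using assms
proof (induction bs arbitrary: u v)
  case (Cons b bs)
  from Cons.prems(2) consider t where "b = u @ t" "v = t @ concat bs" | t where "concat bs = t @ v"
    by (auto simp: append_eq_append_conv2)
  then show ?case
  proof cases
    case 1
    have b: "irreducible_block x b" "avg x b < c" using Cons.prems by auto
    have t: "dev x c t \<le> 0 \<and> (t \<noteq> [] \<longrightarrow> dev x c t < 0)"
    proof (cases "t = [] \<or> u = []")
      case True
      then show ?thesis using b 1 dev_sign(1)[of b x c] by (auto simp: irreducible_block_def)
    next
      case False
      then have "dev x (avg x b) t < 0" using irreducible_block_suffix[of x u t] b 1 by simp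
      then show ?thesis using dev_antimono[of "avg x b" c x t] b by simp
    qed
    have "dev x c (concat bs) \<le> 0 \<and> (concat bs \<noteq> [] \<longrightarrow> dev x c (concat bs) < 0)"
      using Cons.IH[of "[]" "concat bs"] Cons.prems by auto
    with t 1 show ?thesis by auto
  next
    case 2
    with Cons.IH Cons.prems show ?thesis by auto
  qed
qed simp

lemma prefix_above_blocks:
  assumes "\<forall>b\<in>set bs. irreducible_block x b \<and> c < avg x b" "concat bs = u @ v"
  shows "dev x c u \<ge> 0 \<and> (u \<noteq> [] \<longrightarrow> dev x c u > 0)"
  using assms
proof (induction bs arbitrary: u v)
  case (Cons b bs)
  have b: "irreducible_block x b" "c < avg x b" using Cons.prems by auto
  then have bpos: "dev x c b > 0" using dev_sign(2)[of b x c] by (auto simp: irreducible_block_def)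
  from Cons.prems(2) consider t where "b = u @ t" | t where "u = b @ t" "concat bs = t @ v"
    by (auto simp: append_eq_append_conv2)
  then show ?case
  proof cases
    case 1
    show ?thesis
    proof (cases "t = [] \<or> u = []")
      case True
      then show ?thesis using bpos 1 by auto
    next
      case False
      then have "dev x (avg x b) u > 0" using irreducible_block_prefix[of x u t] b 1 by simp
      then show ?thesis using dev_antimono[of c "avg x b" x u] b by simp
    qed
  next
    case 2
    with Cons.IH[of t v] Cons.prems bpos show ?thesis by auto
  qed
qed simp

text \<open>In \<open>p @ (u @ a # v) @ q\<close>, the face containing \<open>a\<close> is \<open>u @ a # v\<close>. The last two conditions determine
  where it has to be inserted into \<open>p @ q\<close>.\<close>
definition block_around :: "('i \<Rightarrow> real) \<Rightarrow> 'i \<Rightarrow> 'i list \<Rightarrow> 'i list \<Rightarrow> 'i list \<Rightarrow> 'i list \<Rightarrow> bool" where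
  "block_around x a p u v q \<longleftrightarrow> irreducible_block x (u @ a # v) \<and>
     (\<forall>p1 p2. p = p1 @ p2 \<longrightarrow> p2 \<noteq> [] \<longrightarrow> dev x (avg x (u @ a # v)) p2 < 0) \<and>
     (\<forall>q1 q2. q = q1 @ q2 \<longrightarrow> q1 \<noteq> [] \<longrightarrow> dev x (avg x (u @ a # v)) q1 > 0)"

text \<open>The face is the block containing \<open>a\<close>; the blocks before it have smaller
  averages and those after it larger ones, which gives the two conditions on \<open>p\<close> and
  \<open>q\<close>.\<close>

lemma block_around_exists:
  assumes "generic_on x X" "distinct l" "set l \<subseteq> X" "a \<in> set l"
  shows "\<exists>p u v q. l = p @ (u @ a # v) @ q \<and> block_around x a p u v q"
proof -
  obtain bs where bs: "concat bs = l" "block_decomposition x bs"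
    using block_decomposition_exists assms by blast
  then obtain b where "b \<in> set bs" "a \<in> set b" using assms(4) by auto
  then obtain bs1 bs2 u v where split: "bs = bs1 @ b # bs2" and b: "b = u @ a # v"
    by (meson split_list)
  have 1: "\<forall>c\<in>set bs1. irreducible_block x c \<and> avg x c < avg x b"
    and 2: "\<forall>c\<in>set bs2. irreducible_block x c \<and> avg x b < avg x c"
    and 3: "irreducible_block x b"
    using bs(2) unfolding split block_decomposition_def by (auto simp: sorted_wrt_append)
  have "block_around x a (concat bs1) u v (concat bs2)"
    unfolding block_around_def b[symmetric]
    using 3 suffix_below_blocks[OF 1] prefix_above_blocks[OF 2] by blast
  moreover have "l = concat bs1 @ (u @ a # v) @ concat bs2" using bs(1) split b by simp
  ultimately show ?thesis by blast
qed

text \<open>The two orders demand opposite strict inequalities between the averages of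
  \<open>u\<close> and \<open>v\<close>. Hence a cyclic arrangement has at most one irreducible
  rotation, as in the cycle lemma.\<close>

lemma irreducible_block_rotation_unique:
  assumes "irreducible_block x (u @ v)" "irreducible_block x (v @ u)"
  shows "u = [] \<or> v = []"
proof (rule ccontr)
  assume "\<not> ?thesis"
  then have "avg x v < avg x u" "avg x u < avg x v"
    using assms unfolding irreducible_block_def by blast+
  then show False by simp
qed

text \<open>\<open>v @ u\<close> is the face read cyclically from just after \<open>a\<close>. Two
  faces with the same reading are rotations of each other, so irreducibility makes them
  equal.\<close>

lemma block_around_unique_block:
  assumes "block_around x a p u v q" "block_around x a p' u' v' q'"
    and eq: "v @ u = v' @ u'"
  shows "u = u' \<and> v = v'"
proof -
  have *: "t = []" if "v' = v @ t" "u = t @ u'" "block_around x a p u v q" "block_around x a p' u' v' q'"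
    for t u v u' v' p q p' q'
    using that irreducible_block_rotation_unique[of x t "u' @ a # v"] by (auto simp: block_around_def)
  from eq consider t where "v' = v @ t" "u = t @ u'" | t where "v = v' @ t" "u' = t @ u"
    by (auto simp: append_eq_append_conv2)
  then show ?thesis
  proof cases
    case 1
    then show ?thesis using *[OF 1] assms by simp
  next
    case 2
    then show ?thesis using *[OF 2] assms by simp
  qed
qed

text \<open>If the places of insertion differed, the segment \<open>t\<close> between them would
  follow the face in one list and precede it in the other, so its deviation would be both positive
  and negative.\<close>

lemma block_around_unique_position:
  assumes "block_around x a p u v q" "block_around x a p' u v q'" and eq: "p @ q = p' @ q'"
  shows "p = p' \<and> q = q'"
proof -
  have *: "t = []" if "p' = p @ t" "q = t @ q'" "block_around x a p u v q" "block_around x a p' u v q'"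
    for t p q p' q'
  proof (rule ccontr)
    assume "t \<noteq> []"
    then have "dev x (avg x (u @ a # v)) t < 0" "dev x (avg x (u @ a # v)) t > 0"
      using that unfolding block_around_def by blast+
    then show False by simp
  qed
  from eq consider t where "p' = p @ t" "q = t @ q'" | t where "p = p' @ t" "q' = t @ q"
    by (auto simp: append_eq_append_conv2)
  then show ?thesis
  proof cases
    case 1
    then show ?thesis using *[OF 1] assms by simp
  next
    case 2
    then show ?thesis using *[OF 2] assms by simp
  qed
qed

section \<open>The monotone cone along a list\<close>

text \<open>For a closed convex cone, the supremum of \<open>gain x\<close> over the cone is the squared norm of the
  projection of \<open>x\<close> onto it.\<close>
definition gain :: "('i \<Rightarrow> real) \<Rightarrow> ('i \<Rightarrow> real) \<Rightarrow> 'i set \<Rightarrow> real" where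
  "gain x \<theta> A = (\<Sum>i\<in>A. 2 * x i * \<theta> i - (\<theta> i)\<^sup>2)"

text \<open>For \<kappa> \<ge> 0, the exponential of \<kappa> times the squared norm of the
  projection onto sequences increasing along \<open>l\<close>. A supremum in \<open>ennreal\<close>
  raises no question of attainment.\<close>

definition cone_exp :: "real \<Rightarrow> ('i \<Rightarrow> real) \<Rightarrow> 'i list \<Rightarrow> ennreal" where
  "cone_exp \<kappa> x l = (SUP \<theta>\<in>{\<theta>. sorted (map \<theta> l)}. ennreal (exp (\<kappa> * gain x \<theta> (set l))))"

text \<open>The analogue of \<open>cone_exp\<close> for the line of sequences constant on
  \<open>B\<close>: there the maximal gain is the squared sum divided by the size.\<close>

definition block_exp :: "real \<Rightarrow> ('i \<Rightarrow> real) \<Rightarrow> 'i set \<Rightarrow> ennreal" where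
  "block_exp \<kappa> x B = ennreal (exp (\<kappa> * ((\<Sum>i\<in>B. x i)\<^sup>2 / real (card B))))"

text \<open>Summation by parts: each prefix deviation is nonnegative and is multiplied by values of
  \<theta> that only increase as the list is extended.\<close>

lemma sum_dev_mult_le:
  assumes "\<And>u v. l = u @ v \<Longrightarrow> dev x c u \<ge> 0" "sorted (map \<theta> l)" "l \<noteq> []"
  shows "(\<Sum>i\<leftarrow>l. (x i - c) * \<theta> i) \<le> dev x c l * \<theta> (last l)"
  using assms
proof (induction l rule: rev_induct)
  case (snoc z l)
  show ?case
  proof (cases "l = []")
    case False
    have "(\<Sum>i\<leftarrow>l. (x i - c) * \<theta> i) \<le> dev x c l * \<theta> (last l)"
      using snoc.prems False by (intro snoc.IH) (auto simp: sorted_append)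
    also have "\<dots> \<le> dev x c l * \<theta> z"
      using snoc.prems(1)[of l "[z]"] snoc.prems(2) False
      by (intro mult_left_mono) (auto simp: sorted_append)
    finally show ?thesis by (simp add: algebra_simps)
  qed simp
qed simp

text \<open>After centring \<open>x\<close> at its average \<open>c\<close>, the centred part
  contributes at most 0 because prefixes lie above the chord. The rest is bounded pointwise by
  \<open>2 * c * t - t^2 \<le> c^2\<close>.\<close>

lemma gain_irreducible_block_le:
  assumes irr: "irreducible_block x b" and "distinct b" "sorted (map \<theta> b)"
  shows "gain x \<theta> (set b) \<le> (\<Sum>i\<in>set b. x i)\<^sup>2 / real (card (set b))"
proof -
  let ?c = "avg x b"
  have ne: "b \<noteq> []" using irr by (simp add: irreducible_block_def)
  have total: "dev x ?c b = 0" using dev_sign(3)[OF ne] by blast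
  have "dev x ?c u \<ge> 0" if "b = u @ v" for u v
    using that irreducible_block_prefix[of x u v] irr total by (cases "u = [] \<or> v = []") auto
  then have "(\<Sum>i\<leftarrow>b. (x i - ?c) * \<theta> i) \<le> 0"
    using sum_dev_mult_le[of b x ?c \<theta>] assms ne total by simp
  then have 1: "(\<Sum>i\<in>set b. (x i - ?c) * \<theta> i) \<le> 0"
    using assms by (simp add: sum_list_distinct_conv_sum_set)
  have "gain x \<theta> (set b) = 2 * (\<Sum>i\<in>set b. (x i - ?c) * \<theta> i) + (\<Sum>i\<in>set b. 2 * ?c * \<theta> i - (\<theta> i)\<^sup>2)"
    unfolding gain_def sum_distrib_left sum.distrib[symmetric] by (simp add: algebra_simps)
  also have "\<dots> \<le> (\<Sum>i\<in>set b. 2 * ?c * \<theta> i - (\<theta> i)\<^sup>2)" using 1 by simp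
  also have "\<dots> \<le> (\<Sum>i\<in>set b. ?c\<^sup>2)"
  proof (rule sum_mono)
    fix i show "2 * ?c * \<theta> i - (\<theta> i)\<^sup>2 \<le> ?c\<^sup>2"
      using zero_le_power2[of "?c - \<theta> i"] by (simp add: power2_diff)
  qed
  also have "\<dots> = (\<Sum>i\<in>set b. x i)\<^sup>2 / real (card (set b))"
    using assms ne by (simp add: avg_def sum_list_distinct_conv_sum_set distinct_card power2_eq_square)
  finally show ?thesis .
qed

text \<open>The gain is additive over disjoint sets, and forgetting the order constraints between
  \<open>b\<close> and the other indices only enlarges the supremum.\<close>

lemma cone_exp_remove_block:
  assumes "irreducible_block x b" "distinct (p @ b @ q)" "\<kappa> \<ge> 0"
  shows "cone_exp \<kappa> x (p @ b @ q) \<le> block_exp \<kappa> x (set b) * cone_exp \<kappa> x (p @ q)"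
  unfolding cone_exp_def[of _ _ "p @ b @ q"]
proof (rule SUP_least, clarify)
  fix \<theta> :: "'a \<Rightarrow> real" assume s: "sorted (map \<theta> (p @ b @ q))"
  have split: "gain x \<theta> (set (p @ b @ q)) = gain x \<theta> (set b) + gain x \<theta> (set (p @ q))"
  proof -
    have eq: "set (p @ b @ q) = set b \<union> set (p @ q)" by auto
    show ?thesis unfolding gain_def eq using assms(2) by (intro sum.union_disjoint) auto
  qed
  have le: "gain x \<theta> (set b) \<le> (\<Sum>i\<in>set b. x i)\<^sup>2 / real (card (set b))"
    using s assms by (intro gain_irreducible_block_le) (auto simp: sorted_append)
  have "ennreal (exp (\<kappa> * gain x \<theta> (set (p @ b @ q))))
      = ennreal (exp (\<kappa> * gain x \<theta> (set b))) * ennreal (exp (\<kappa> * gain x \<theta> (set (p @ q))))"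
    unfolding split by (simp add: distrib_left exp_add ennreal_mult)
  also have "\<dots> \<le> block_exp \<kappa> x (set b) * cone_exp \<kappa> x (p @ q)"
  proof (rule mult_mono)
    show "ennreal (exp (\<kappa> * gain x \<theta> (set b))) \<le> block_exp \<kappa> x (set b)"
      unfolding block_exp_def using mult_left_mono[OF le assms(3)] by (intro ennreal_leI) simp
    show "ennreal (exp (\<kappa> * gain x \<theta> (set (p @ q)))) \<le> cone_exp \<kappa> x (p @ q)"
      unfolding cone_exp_def using s by (intro SUP_upper) (auto simp: sorted_append)
  qed auto
  finally show "ennreal (exp (\<kappa> * gain x \<theta> (set (p @ b @ q))))
    \<le> block_exp \<kappa> x (set b) * cone_exp \<kappa> x (p @ q)" .
qed

text \<open>Each ordering is charged to the pair left after removing the face around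
  \<open>a\<close>. The charging map is injective, so enlarging the sum to all pairs gives an upper
  bound.\<close>

lemma sum_permutations_cone_exp_le:
  assumes gen: "generic_on x X" and X: "finite X" "a \<in> X" and "\<kappa> \<ge> 0"
  shows "(\<Sum>l\<in>permutations_of_set X. cone_exp \<kappa> x l)
    \<le> (\<Sum>l\<in>permutations_of_set (X - {a}). \<Sum>i<card X.
          block_exp \<kappa> x (set (a # take i l)) * cone_exp \<kappa> x (drop i l))"
proof -
  define f where "f = (\<lambda>(l, i). block_exp \<kappa> x (set (a # take i l)) * cone_exp \<kappa> x (drop i l))"
  define T where "T = permutations_of_set (X - {a}) \<times> {..<card X}"
  have "\<exists>p u v q. l = p @ (u @ a # v) @ q \<and> block_around x a p u v q" if "l \<in> permutations_of_set X" for l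
    using block_around_exists[OF gen, of l a] that X by (auto simp: permutations_of_set_def)
  then obtain p u v q where
    eq: "\<And>l. l \<in> permutations_of_set X \<Longrightarrow> l = p l @ (u l @ a # v l) @ q l" and
    around: "\<And>l. l \<in> permutations_of_set X \<Longrightarrow> block_around x a (p l) (u l) (v l) (q l)"
    by metis
  \<comment> \<open>The cyclic reading of the face without \<open>a\<close> comes first; the length
    records where it ends, so both parts can be recovered.\<close>
  define \<Phi> where "\<Phi> l = ((v l @ u l) @ (p l @ q l), length (v l @ u l))" for l
  have inj: "inj_on \<Phi> (permutations_of_set X)"
  proof (rule inj_onI)
    fix l l' assume l: "l \<in> permutations_of_set X" "l' \<in> permutations_of_set X" "\<Phi> l = \<Phi> l'"
    then have "v l @ u l = v l' @ u l'" "p l @ q l = p l' @ q l'"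
      unfolding \<Phi>_def using append_eq_append_conv by blast+
    then show "l = l'"
      using block_around_unique_block block_around_unique_position around l(1,2) eq by metis
  qed
  have sub: "\<Phi> ` permutations_of_set X \<subseteq> T"
  proof
    fix t assume "t \<in> \<Phi> ` permutations_of_set X"
    then obtain l where l: "l \<in> permutations_of_set X" "t = \<Phi> l" by auto
    have "distinct l" "set l = X" using l by (auto simp: permutations_of_set_def)
    moreover have "card X = length l" using calculation distinct_card by force
    moreover note eq[OF l(1)]
    ultimately have "distinct (p l @ (u l @ a # v l) @ q l)" "set (p l @ (u l @ a # v l) @ q l) = X"
      "card X = length (p l @ (u l @ a # v l) @ q l)" by metis+
    then show "t \<in> T" unfolding l(2) T_def \<Phi>_def by (auto simp: permutations_of_set_def)
  qed
  have "(\<Sum>l\<in>permutations_of_set X. cone_exp \<kappa> x l) \<le> (\<Sum>l\<in>permutations_of_set X. f (\<Phi> l))"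
  proof (rule sum_mono)
    fix l assume l: "l \<in> permutations_of_set X"
    have "distinct l" using l by (auto simp: permutations_of_set_def)
    then have "cone_exp \<kappa> x (p l @ (u l @ a # v l) @ q l)
        \<le> block_exp \<kappa> x (set (u l @ a # v l)) * cone_exp \<kappa> x (p l @ q l)"
      using around[OF l] eq[OF l] \<open>\<kappa> \<ge> 0\<close> by (intro cone_exp_remove_block) (auto simp: block_around_def)
    also have "set (u l @ a # v l) = set (a # v l @ u l)" by auto
    finally show "cone_exp \<kappa> x l \<le> f (\<Phi> l)" using eq[OF l] by (simp add: f_def \<Phi>_def)
  qed
  also have "\<dots> = sum f (\<Phi> ` permutations_of_set X)" using inj by (simp add: sum.reindex)
  also have "\<dots> \<le> sum f T" using sub by (intro sum_mono2) (auto simp: T_def)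
  also have "\<dots> = (\<Sum>l\<in>permutations_of_set (X - {a}). \<Sum>i<card X. f (l, i))"
    unfolding T_def by (simp add: sum.cartesian_product)
  finally show ?thesis by (simp add: f_def)
qed

section \<open>Exponential moments for normal increments\<close>

lemma tendsto_floor_mult_divide: "(\<lambda>N. of_int \<lfloor>real (Suc N) * t\<rfloor> / real (Suc N)) \<longlonglongrightarrow> t"
proof (rule tendsto_sandwich)
  show "\<forall>\<^sub>F N in sequentially. t - 1 / real (Suc N) \<le> of_int \<lfloor>real (Suc N) * t\<rfloor> / real (Suc N)"
  proof (intro always_eventually allI)
    fix N
    have "real (Suc N) * t - 1 \<le> of_int \<lfloor>real (Suc N) * t\<rfloor>" by linarith
    then have "(real (Suc N) * t - 1) / real (Suc N) \<le> of_int \<lfloor>real (Suc N) * t\<rfloor> / real (Suc N)"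
      by (intro divide_right_mono) auto
    then show "t - 1 / real (Suc N) \<le> of_int \<lfloor>real (Suc N) * t\<rfloor> / real (Suc N)"
      by (simp add: diff_divide_distrib)
  qed
  show "\<forall>\<^sub>F N in sequentially. of_int \<lfloor>real (Suc N) * t\<rfloor> / real (Suc N) \<le> t"
    by (intro always_eventually allI) (simp add: pos_divide_le_eq mult.commute)
  show "(\<lambda>N. t - 1 / real (Suc N)) \<longlonglongrightarrow> t" using LIMSEQ_inverse_real_of_nat_add_minus[of t] by (simp add: inverse_eq_divide)
qed simp

text \<open>Reduces the supremum to a countable one, for measurability. Extensional functions are
  used because only finitely many values may vary.\<close>

lemma cone_exp_eq_rational:
  "cone_exp \<kappa> x l = (SUP \<theta>\<in>{\<theta>\<in>set l \<rightarrow>\<^sub>E \<rat>. sorted (map \<theta> l)}. ennreal (exp (\<kappa> * gain x \<theta> (set l))))"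
  (is "_ = ?R")
proof (rule antisym)
  show "?R \<le> cone_exp \<kappa> x l"
    unfolding cone_exp_def by (rule SUP_subset_mono) auto
  show "cone_exp \<kappa> x l \<le> ?R"
    unfolding cone_exp_def
  proof (rule SUP_least, clarify)
    fix \<theta> :: "'a \<Rightarrow> real" assume s: "sorted (map \<theta> l)"
    \<comment> \<open>Rounding down to multiples of 1/(N+1) is monotone, so it preserves
      sortedness.\<close>
    define r where "r N = (\<lambda>i\<in>set l. of_int \<lfloor>real (Suc N) * \<theta> i\<rfloor> / real (Suc N))" for N
    have conv: "(\<lambda>N. r N i) \<longlonglongrightarrow> \<theta> i" if "i \<in> set l" for i
      using tendsto_floor_mult_divide[of "\<theta> i"] that by (simp add: r_def)
    have lim: "(\<lambda>N. ennreal (exp (\<kappa> * gain x (r N) (set l)))) \<longlonglongrightarrow> ennreal (exp (\<kappa> * gain x \<theta> (set l)))"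
      unfolding gain_def by (intro tendsto_ennrealI tendsto_intros conv)
    have "ennreal (exp (\<kappa> * gain x (r N) (set l))) \<le> ?R" for N
    proof (rule SUP_upper)
      have "sorted (map (r N) l)"
        using s unfolding sorted_iff_nth_mono
        by (auto simp: r_def intro!: divide_right_mono floor_mono mult_left_mono)
      then show "r N \<in> {\<theta> \<in> set l \<rightarrow>\<^sub>E \<rat>. sorted (map \<theta> l)}" by (auto simp: r_def)
    qed
    then show "ennreal (exp (\<kappa> * gain x \<theta> (set l))) \<le> ?R"
      by (intro LIMSEQ_le_const2[OF lim]) auto
  qed
qed

lemma cone_exp_measurable:
  assumes [measurable]: "\<And>i. i \<in> set l \<Longrightarrow> X i \<in> borel_measurable M"
  shows "(\<lambda>\<omega>. cone_exp \<kappa> (\<lambda>i. X i \<omega>) l) \<in> borel_measurable M"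
proof -
  have "countable {\<theta>\<in>set l \<rightarrow>\<^sub>E (\<rat> :: real set). sorted (map \<theta> l)}"
    by (rule countable_subset[of _ "set l \<rightarrow>\<^sub>E \<rat>"]) (auto intro: countable_PiE countable_rat)
  then show ?thesis unfolding cone_exp_eq_rational gain_def by measurable
qed

lemma cone_exp_cong:
  assumes "\<And>i. i \<in> set l \<Longrightarrow> x i = y i"
  shows "cone_exp \<kappa> x l = cone_exp \<kappa> y l"
proof -
  have "gain x \<theta> (set l) = gain y \<theta> (set l)" for \<theta>
    unfolding gain_def by (rule sum.cong) (simp_all add: assms)
  then show ?thesis by (simp add: cone_exp_def)
qed

lemma cone_exp_map:
  assumes inj: "inj_on f (set l)"
  shows "cone_exp \<kappa> x (map f l) = cone_exp \<kappa> (x \<circ> f) l"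
proof (rule antisym)
  have gain: "gain x \<theta> (set (map f l)) = gain (x \<circ> f) (\<theta> \<circ> f) (set l)" for \<theta>
    unfolding gain_def using inj by (simp add: sum.reindex)
  show "cone_exp \<kappa> x (map f l) \<le> cone_exp \<kappa> (x \<circ> f) l"
    unfolding cone_exp_def[of _ _ "map f l"]
  proof (rule SUP_least, clarify)
    fix \<theta> :: "'b \<Rightarrow> real" assume "sorted (map \<theta> (map f l))"
    then show "ennreal (exp (\<kappa> * gain x \<theta> (set (map f l)))) \<le> cone_exp \<kappa> (x \<circ> f) l"
      unfolding gain cone_exp_def by (intro SUP_upper) (simp add: comp_def)
  qed
  show "cone_exp \<kappa> (x \<circ> f) l \<le> cone_exp \<kappa> x (map f l)"
    unfolding cone_exp_def[of _ _ l]
  proof (rule SUP_least, clarify)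
    fix \<theta> :: "'a \<Rightarrow> real" assume s: "sorted (map \<theta> l)"
    let ?\<theta> = "\<theta> \<circ> inv_into (set l) f"
    have m: "map ?\<theta> (map f l) = map \<theta> l" using inj by simp
    have eq: "gain (x \<circ> f) \<theta> (set l) = gain x ?\<theta> (set (map f l))"
      unfolding gain unfolding gain_def by (rule sum.cong) (simp_all add: inj)
    show "ennreal (exp (\<kappa> * gain (x \<circ> f) \<theta> (set l))) \<le> cone_exp \<kappa> x (map f l)"
      unfolding cone_exp_def using s by (intro SUP_upper2[of ?\<theta>]) (simp_all only: mem_Collect_eq m eq order_refl)
  qed
qed

lemma (in prob_space) AE_distributed_neq:
  assumes "distributed M lborel X f"
  shows "AE \<omega> in M. X \<omega> \<noteq> (c :: real)"
proof -
  have [measurable]: "X \<in> borel_measurable M" "f \<in> borel_measurable lborel"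
    using assms by (auto simp: distributed_def)
  have "AE t in lborel. t \<noteq> c" using AE_lborel_singleton by auto
  then have "AE t in density lborel f. t \<noteq> c"
    by (auto simp: AE_density elim: AE_mp)
  then have "AE t in distr M lborel X. t \<noteq> c"
    unfolding distributed_distr_eq_density[OF assms] .
  then show ?thesis by (subst (asm) AE_distr_iff) auto
qed

text \<open>The exponent is tuned so that the integrand is \<open>s\<close> times the normal density
  with standard deviation \<open>s * \<tau>\<close>.\<close>

lemma nn_integral_exp_square_normal:
  assumes "0 < s" "0 < \<tau>"
  shows "(\<integral>\<^sup>+z. ennreal (normal_density 0 \<tau> z) * ennreal (exp ((1 - 1 / s\<^sup>2) / (2 * \<tau>\<^sup>2) * z\<^sup>2)) \<partial>lborel) = ennreal s"
proof -
  have "normal_density 0 \<tau> z * exp ((1 - 1 / s\<^sup>2) / (2 * \<tau>\<^sup>2) * z\<^sup>2) = s * normal_density 0 (s * \<tau>) z" for z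
  proof -
    have "exp (- (z\<^sup>2) / (2 * \<tau>\<^sup>2)) * exp ((1 - 1 / s\<^sup>2) / (2 * \<tau>\<^sup>2) * z\<^sup>2) = exp (- (z\<^sup>2) / (2 * (s * \<tau>)\<^sup>2))"
      unfolding exp_add[symmetric] using assms
      by (intro arg_cong[of _ _ exp]) (simp add: power_mult_distrib field_simps)
    moreover have "sqrt (2 * pi * (s * \<tau>)\<^sup>2) = s * sqrt (2 * pi * \<tau>\<^sup>2)"
      using assms by (simp add: real_sqrt_mult power_mult_distrib)
    ultimately show ?thesis
      unfolding normal_density_def using assms by (simp add: algebra_simps)
  qed
  then have "(\<integral>\<^sup>+z. ennreal (normal_density 0 \<tau> z) * ennreal (exp ((1 - 1 / s\<^sup>2) / (2 * \<tau>\<^sup>2) * z\<^sup>2)) \<partial>lborel)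
     = (\<integral>\<^sup>+z. ennreal s * ennreal (normal_density 0 (s * \<tau>) z) \<partial>lborel)"
    using assms by (simp add: ennreal_mult[symmetric])
  also have "\<dots> = ennreal s * (\<integral>\<^sup>+z. ennreal (normal_density 0 (s * \<tau>) z) \<partial>lborel)"
    by (rule nn_integral_cmult) measurable
  also have "(\<integral>\<^sup>+z. ennreal (normal_density 0 (s * \<tau>) z) \<partial>lborel) = 1"
    using prob_space.emeasure_space_1[OF prob_space_normal_density[of "s * \<tau>" 0]] assms
    by (simp add: emeasure_density)
  finally show ?thesis by simp
qed

section \<open>Independent normal increments: genericity, factorisation and exchangeability\<close>

locale iid_normal = prob_space M for M :: "'a measure" +
  fixes \<xi> :: "'i \<Rightarrow> 'a \<Rightarrow> real" and I :: "'i set" and \<sigma> :: real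
  assumes finite_I: "finite I"
    and sigma_pos: "\<sigma> > 0"
    and indep: "indep_vars (\<lambda>_. borel) \<xi> I"
    and normal: "i \<in> I \<Longrightarrow> distributed M lborel (\<xi> i) (normal_density 0 \<sigma>)"
begin

lemma xi_measurable [measurable]: "i \<in> I \<Longrightarrow> \<xi> i \<in> borel_measurable M"
  using normal by (auto simp: distributed_def)

text \<open>For each of countably many pairs, the difference of the two averages is a nondegenerate
  normal variable, hence almost surely nonzero.\<close>

lemma AE_generic: "AE \<omega> in M. generic_on (\<lambda>i. \<xi> i \<omega>) I"
proof -
  define P where "P = {(u, v). u \<noteq> [] \<and> v \<noteq> [] \<and> distinct (u @ v) \<and> set (u @ v) \<subseteq> I}"
  have "countable P"
    by (rule countable_subset[of _ "lists I \<times> lists I"])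
      (use finite_I in \<open>auto simp: P_def intro!: countable_SIGMA countable_lists intro: countable_finite\<close>)
  moreover have "AE \<omega> in M. avg (\<lambda>i. \<xi> i \<omega>) u \<noteq> avg (\<lambda>i. \<xi> i \<omega>) v" if uv: "(u, v) \<in> P" for u v
  proof -
    define c where "c i = (if i \<in> set u then 1 / real (length u) else - 1 / real (length v))" for i
    have ne: "u \<noteq> []" "v \<noteq> []" "distinct u" "distinct v" "set u \<inter> set v = {}" "set u \<union> set v \<subseteq> I"
      using uv by (auto simp: P_def)
    have c0: "c i \<noteq> 0" for i using ne by (simp add: c_def)
    have "distributed M lborel (\<lambda>\<omega>. \<Sum>i\<in>set u \<union> set v. c i * \<xi> i \<omega>)
      (normal_density (\<Sum>i\<in>set u \<union> set v. 0) (sqrt (\<Sum>i\<in>set u \<union> set v. (\<bar>c i\<bar> * \<sigma>)\<^sup>2)))"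
    proof (rule sum_indep_normal)
      show "indep_vars (\<lambda>_. borel) (\<lambda>i \<omega>. c i * \<xi> i \<omega>) (set u \<union> set v)"
        by (rule indep_vars_compose2[OF indep_vars_subset[OF indep ne(6)], of "\<lambda>i t. c i * t"]) auto
      show "distributed M lborel (\<lambda>\<omega>. c i * \<xi> i \<omega>) (normal_density 0 (\<bar>c i\<bar> * \<sigma>))"
        if "i \<in> set u \<union> set v" for i
        using normal_density_affine[OF normal sigma_pos c0, of i 0 i] that ne(6) by auto
    qed (use ne sigma_pos c0 in auto)
    from AE_distributed_neq[OF this, of 0]
    show ?thesis
    proof (rule AE_mp, intro AE_I2 impI)
      fix \<omega> assume nz: "(\<Sum>i\<in>set u \<union> set v. c i * \<xi> i \<omega>) \<noteq> 0"
      have "(\<Sum>i\<in>set u \<union> set v. c i * \<xi> i \<omega>) = (\<Sum>i\<in>set u. c i * \<xi> i \<omega>) + (\<Sum>i\<in>set v. c i * \<xi> i \<omega>)"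
        using ne by (intro sum.union_disjoint) auto
      also have "(\<Sum>i\<in>set u. c i * \<xi> i \<omega>) = avg (\<lambda>i. \<xi> i \<omega>) u"
        using ne by (simp add: avg_def c_def sum_list_distinct_conv_sum_set sum_divide_distrib)
      also have "(\<Sum>i\<in>set v. c i * \<xi> i \<omega>) = (\<Sum>i\<in>set v. - (\<xi> i \<omega> / real (length v)))"
        using ne by (intro sum.cong) (auto simp: c_def)
      also have "\<dots> = - avg (\<lambda>i. \<xi> i \<omega>) v"
        using ne by (simp add: avg_def sum_list_distinct_conv_sum_set sum_divide_distrib sum_negf)
      finally show "avg (\<lambda>i. \<xi> i \<omega>) u \<noteq> avg (\<lambda>i. \<xi> i \<omega>) v" using nz by simp
    qed
  qed
  ultimately have "AE \<omega> in M. \<forall>(u, v)\<in>P. avg (\<lambda>i. \<xi> i \<omega>) u \<noteq> avg (\<lambda>i. \<xi> i \<omega>) v"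
    by (subst AE_ball_countable) auto
  then show ?thesis by (rule AE_mp) (auto simp: generic_on_def P_def)
qed

lemma nn_integral_prod_disjoint:
  assumes L: "finite L" "disjoint_family_on K L" "\<And>j. j \<in> L \<Longrightarrow> K j \<subseteq> I"
    and meas: "\<And>j. j \<in> L \<Longrightarrow> f j \<in> borel_measurable (PiM (K j) (\<lambda>_. borel))"
    and eq: "\<And>j \<omega>. j \<in> L \<Longrightarrow> g j \<omega> = f j (\<lambda>i\<in>K j. \<xi> i \<omega>)"
  shows "(\<integral>\<^sup>+\<omega>. (\<Prod>j\<in>L. g j \<omega>) \<partial>M) = (\<Prod>j\<in>L. \<integral>\<^sup>+\<omega>. g j \<omega> \<partial>M :: ennreal)"
proof -
  have "indep_vars (\<lambda>_. borel) (\<lambda>j \<omega>. f j (\<lambda>i\<in>K j. \<xi> i \<omega>)) L"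
    by (rule indep_vars_compose2[OF indep_vars_restrict[OF indep L(3) L(2)]]) (auto intro: meas)
  from indep_vars_nn_integral[OF L(1) this] show ?thesis by (simp add: eq)
qed

text \<open>The normalised squared sum over \<open>B\<close> has the law of one squared normal
  variable, so the moment is \<open>s\<close> whatever the size of the face. This makes the
  recursion solvable.\<close>

lemma nn_integral_block_exp:
  assumes "s > 0" "B \<subseteq> I" "B \<noteq> {}"
  shows "(\<integral>\<^sup>+\<omega>. block_exp ((1 - 1 / s\<^sup>2) / (2 * \<sigma>\<^sup>2)) (\<lambda>i. \<xi> i \<omega>) B \<partial>M) = ennreal s"
proof -
  have fin: "finite B" using assms finite_I finite_subset by blast
  define \<tau> where "\<tau> = sqrt (real (card B) * \<sigma>\<^sup>2)"
  have card: "card B > 0" using fin assms by (simp add: card_gt_0_iff)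
  have \<tau>: "\<tau> > 0" "\<tau>\<^sup>2 = real (card B) * \<sigma>\<^sup>2"
    using card sigma_pos by (auto simp: \<tau>_def)
  have "distributed M lborel (\<lambda>\<omega>. \<Sum>i\<in>B. \<xi> i \<omega>) (normal_density (\<Sum>i\<in>B. 0) (sqrt (\<Sum>i\<in>B. \<sigma>\<^sup>2)))"
    using assms fin sigma_pos indep_vars_subset[OF indep] normal by (intro sum_indep_normal) auto
  then have dist: "distributed M lborel (\<lambda>\<omega>. \<Sum>i\<in>B. \<xi> i \<omega>) (normal_density 0 \<tau>)"
    by (simp add: \<tau>_def)
  have "(\<integral>\<^sup>+\<omega>. block_exp ((1 - 1 / s\<^sup>2) / (2 * \<sigma>\<^sup>2)) (\<lambda>i. \<xi> i \<omega>) B \<partial>M)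
      = (\<integral>\<^sup>+\<omega>. ennreal (exp ((1 - 1 / s\<^sup>2) / (2 * \<tau>\<^sup>2) * (\<Sum>i\<in>B. \<xi> i \<omega>)\<^sup>2)) \<partial>M)"
    using card unfolding block_exp_def \<tau> by (simp add: mult_ac)
  also have "\<dots> = ennreal s"
    using distributed_nn_integral[OF dist, of "\<lambda>z. ennreal (exp ((1 - 1 / s\<^sup>2) / (2 * \<tau>\<^sup>2) * z\<^sup>2))"]
      nn_integral_exp_square_normal[OF assms(1) \<tau>(1)] by simp
  finally show ?thesis .
qed

text \<open>Exchangeability: read along any list of distinct indices, the increments have the same
  product law.\<close>

lemma nn_integral_cone_exp_length:
  assumes l: "distinct l" "set l \<subseteq> I" and l': "distinct l'" "set l' \<subseteq> I" and len: "length l = length l'"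
  shows "(\<integral>\<^sup>+\<omega>. cone_exp \<kappa> (\<lambda>i. \<xi> i \<omega>) l \<partial>M) = (\<integral>\<^sup>+\<omega>. cone_exp \<kappa> (\<lambda>i. \<xi> i \<omega>) l' \<partial>M)"
proof (cases "l = []")
  case False
  have *: "(\<integral>\<^sup>+\<omega>. cone_exp \<kappa> (\<lambda>i. \<xi> i \<omega>) l \<partial>M)
     = (\<integral>\<^sup>+y. cone_exp \<kappa> y [0..<length l] \<partial>PiM {..<length l} (\<lambda>_. density lborel (normal_density 0 \<sigma>)))"
    if l: "distinct l" "set l \<subseteq> I" "l \<noteq> []" for l
  proof -
    let ?L = "{..<length l}" and ?N = "density lborel (normal_density 0 \<sigma>)"
    define \<eta> where "\<eta> j = \<xi> (l ! j)" for j
    have mem: "l ! j \<in> I" if "j \<in> ?L" for j using l that nth_mem by blast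
    \<comment> \<open>Reindexing is obtained by grouping the variables into the singletons
      \<open>{l ! j}\<close>.\<close>
    have "indep_vars (\<lambda>_. borel) (\<lambda>j \<omega>. (\<lambda>i\<in>{l ! j}. \<xi> i \<omega>) (l ! j)) ?L"
    proof (rule indep_vars_compose2[OF indep_vars_restrict[OF indep]])
      show "disjoint_family_on (\<lambda>j. {l ! j}) ?L"
        using l(1) by (auto simp: disjoint_family_on_def nth_eq_iff_index_eq)
    qed (use mem in auto)
    then have ind: "indep_vars (\<lambda>_. borel) \<eta> ?L" by (simp add: \<eta>_def[abs_def])
    have meas [measurable]: "\<eta> j \<in> borel_measurable M" if "j \<in> ?L" for j
      using mem[OF that] by (simp add: \<eta>_def)
    have "distr M (PiM ?L (\<lambda>_. borel)) (\<lambda>\<omega>. \<lambda>j\<in>?L. \<eta> j \<omega>) = (\<Pi>\<^sub>M j\<in>?L. distr M borel (\<eta> j))"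
      using ind l(3) meas by (subst (asm) indep_vars_iff_distr_eq_PiM') auto
    also have "\<dots> = PiM ?L (\<lambda>_. ?N)"
    proof (rule PiM_cong)
      fix j assume "j \<in> ?L"
      have "distr M borel (\<eta> j) = distr M lborel (\<eta> j)" by (rule distr_cong) auto
      also have "\<dots> = ?N" using normal[OF mem[OF \<open>j \<in> ?L\<close>]] by (simp add: \<eta>_def distributed_distr_eq_density)
      finally show "distr M borel (\<eta> j) = ?N" .
    qed simp
    finally have distr: "distr M (PiM ?L (\<lambda>_. borel)) (\<lambda>\<omega>. \<lambda>j\<in>?L. \<eta> j \<omega>) = PiM ?L (\<lambda>_. ?N)" .
    have "cone_exp \<kappa> (\<lambda>i. \<xi> i \<omega>) l = cone_exp \<kappa> (\<lambda>j\<in>?L. \<eta> j \<omega>) [0..<length l]" for \<omega>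
    proof -
      have "inj_on ((!) l) (set [0..<length l])" using l(1) by (simp add: inj_on_nth)
      from cone_exp_map[OF this, of \<kappa> "\<lambda>i. \<xi> i \<omega>"]
      have "cone_exp \<kappa> (\<lambda>i. \<xi> i \<omega>) l = cone_exp \<kappa> ((\<lambda>i. \<xi> i \<omega>) \<circ> (!) l) [0..<length l]"
        by (simp add: map_nth)
      also have "\<dots> = cone_exp \<kappa> (\<lambda>j\<in>?L. \<eta> j \<omega>) [0..<length l]"
        by (rule cone_exp_cong) (simp add: \<eta>_def)
      finally show ?thesis .
    qed
    then have "(\<integral>\<^sup>+\<omega>. cone_exp \<kappa> (\<lambda>i. \<xi> i \<omega>) l \<partial>M)
       = (\<integral>\<^sup>+\<omega>. cone_exp \<kappa> (\<lambda>j\<in>?L. \<eta> j \<omega>) [0..<length l] \<partial>M)" by simp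
    also have "\<dots> = (\<integral>\<^sup>+y. cone_exp \<kappa> y [0..<length l] \<partial>distr M (PiM ?L (\<lambda>_. borel)) (\<lambda>\<omega>. \<lambda>j\<in>?L. \<eta> j \<omega>))"
    proof (rule nn_integral_distr[symmetric])
      show "(\<lambda>\<omega>. \<lambda>j\<in>?L. \<eta> j \<omega>) \<in> M \<rightarrow>\<^sub>M PiM ?L (\<lambda>_. borel)"
        by (intro measurable_restrict meas)
      show "(\<lambda>y. cone_exp \<kappa> y [0..<length l]) \<in> borel_measurable
          (distr M (PiM ?L (\<lambda>_. borel)) (\<lambda>\<omega>. \<lambda>j\<in>?L. \<eta> j \<omega>))"
        by (rule cone_exp_measurable[where X = "\<lambda>i y. y i"]) simp
    qed
    finally show ?thesis unfolding distr .
  qed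
  have "l' \<noteq> []" using False len by auto
  then show ?thesis using *[of l] *[of l'] assms False by simp
qed (use len in simp)

lemma nn_integral_block_exp_cone_exp:
  assumes "s > 0" "B \<subseteq> I" "B \<noteq> {}" "set l \<subseteq> I" "B \<inter> set l = {}"
  defines "\<kappa> \<equiv> (1 - 1 / s\<^sup>2) / (2 * \<sigma>\<^sup>2)"
  shows "(\<integral>\<^sup>+\<omega>. block_exp \<kappa> (\<lambda>i. \<xi> i \<omega>) B * cone_exp \<kappa> (\<lambda>i. \<xi> i \<omega>) l \<partial>M)
    = ennreal s * (\<integral>\<^sup>+\<omega>. cone_exp \<kappa> (\<lambda>i. \<xi> i \<omega>) l \<partial>M)"
proof -
  define K where "K j = (if j then B else set l)" for j
  define f where "f j x = (if j then block_exp \<kappa> x B else cone_exp \<kappa> x l)" for j x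
  have "(\<integral>\<^sup>+\<omega>. (\<Prod>j\<in>UNIV. f j (\<lambda>i. \<xi> i \<omega>)) \<partial>M) = (\<Prod>j\<in>UNIV. \<integral>\<^sup>+\<omega>. f j (\<lambda>i. \<xi> i \<omega>) \<partial>M)"
  proof (rule nn_integral_prod_disjoint)
    show "disjoint_family_on K UNIV" using assms(5) by (auto simp: disjoint_family_on_def K_def)
    show "f j \<in> borel_measurable (PiM (K j) (\<lambda>_. borel))" for j
    proof (cases j)
      case True
      then show ?thesis by (simp add: f_def[abs_def] K_def block_exp_def) measurable
    next
      case False
      then show ?thesis unfolding f_def[abs_def] K_def
        using cone_exp_measurable[where X = "\<lambda>i y. y i" and l = l] by simp
    qed
    show "f j (\<lambda>i. \<xi> i \<omega>) = f j (\<lambda>i\<in>K j. \<xi> i \<omega>)" for j \<omega>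
      by (auto simp: f_def K_def block_exp_def intro: cone_exp_cong)
  qed (use assms in \<open>auto simp: K_def\<close>)
  then show ?thesis
    using nn_integral_block_exp[OF assms(1-3)] by (simp add: UNIV_bool f_def \<kappa>_def mult.commute)
qed

end

section \<open>The recursion for the exponential moments and its solution\<close>

definition growth :: "real \<Rightarrow> nat \<Rightarrow> real" where
  "growth s m = (\<Prod>j=1..m. 1 + (s - 1) / real j)"

lemma growth_nonneg: "s \<ge> 1 \<Longrightarrow> growth s m \<ge> 0"
  unfolding growth_def by (intro prod_nonneg) auto

text \<open>\<open>growth s\<close> solves the recursion with equality; \<open>growth s m\<close> is
  the coefficient of z^m in (1 - z)^(-s).\<close>

lemma sum_growth: "s * (\<Sum>i<m. growth s i) = real m * growth s m"
proof (induction m)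
  case (Suc m)
  have "growth s (Suc m) = growth s m * (1 + (s - 1) / real (Suc m))" by (simp add: growth_def)
  then have "real (Suc m) * growth s (Suc m) = (real m + s) * growth s m"
    by (simp add: field_simps del: of_nat_Suc) (simp add: algebra_simps)
  with Suc show ?case by (simp add: algebra_simps)
qed simp

lemma growth_le_exp:
  assumes "s \<ge> 1" "m \<ge> 1"
  shows "growth s m \<le> exp ((s - 1) * (1 + ln (real m)))"
proof -
  have "growth s m \<le> (\<Prod>j=1..m. exp ((s - 1) / real j))"
    unfolding growth_def using assms by (intro prod_mono) auto
  also have "\<dots> = exp ((s - 1) * harm m)"
    by (simp add: exp_sum harm_def sum_distrib_left divide_inverse)
  also have "harm m \<le> 1 + ln (real m)"
    using euler_mascheroni_sequence_decreasing[of 1 m] assms by (simp add: harm_def)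
  finally show ?thesis using assms by (simp add: mult_left_mono)
qed

context iid_normal
begin

text \<open>By exchangeability, m! times the moment is the sum over all orderings. Removing a face
  leaves (m - 1)! lists and, by independence, a factor \<open>s\<close> times the moment of a
  shorter list. The induction hypothesis and \<open>sum_growth\<close> then give m! times
  \<open>growth s m\<close>.\<close>

lemma nn_integral_cone_exp_le:
  assumes s: "s \<ge> 1" and l: "distinct l" "set l \<subseteq> I"
  defines "\<kappa> \<equiv> (1 - 1 / s\<^sup>2) / (2 * \<sigma>\<^sup>2)"
  shows "(\<integral>\<^sup>+\<omega>. cone_exp \<kappa> (\<lambda>i. \<xi> i \<omega>) l \<partial>M) \<le> ennreal (growth s (length l))"
  using l
proof (induction "length l" arbitrary: l rule: less_induct)
  case less
  show ?case
  proof (cases "l = []")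
    case True
    then show ?thesis by (simp add: cone_exp_def gain_def growth_def emeasure_space_1)
  next
    case False
    let ?G = "\<lambda>l. \<integral>\<^sup>+\<omega>. cone_exp \<kappa> (\<lambda>i. \<xi> i \<omega>) l \<partial>M"
    define X where "X = set l"
    define a where "a = hd l"
    define m where "m = length l"
    have X: "finite X" "a \<in> X" "card X = m" "X \<subseteq> I" "m > 0"
      using False less.prems by (auto simp: X_def a_def m_def distinct_card)
    have \<kappa>: "\<kappa> \<ge> 0" using s by (simp add: \<kappa>_def)
    have meas [measurable]: "(\<lambda>\<omega>. cone_exp \<kappa> (\<lambda>i. \<xi> i \<omega>) l') \<in> borel_measurable M" if "set l' \<subseteq> I" for l'
      using that by (intro cone_exp_measurable) auto
    have meas_block: "(\<lambda>\<omega>. block_exp \<kappa> (\<lambda>i. \<xi> i \<omega>) B) \<in> borel_measurable M" if "B \<subseteq> I" for B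
    proof -
      have "\<xi> i \<in> borel_measurable M" if "i \<in> B" for i using that \<open>B \<subseteq> I\<close> by auto
      then show ?thesis unfolding block_exp_def by measurable
    qed
    have perm: "distinct l'" "set l' = X - {a}" "length l' = m - 1" "set (a # take i l') \<subseteq> I"
      "set (drop i l') \<subseteq> I" "distinct (drop i l')" "set (a # take i l') \<inter> set (drop i l') = {}"
      if "l' \<in> permutations_of_set (X - {a})" for l' i
    proof -
      show *: "distinct l'" "set l' = X - {a}" using that by (auto simp: permutations_of_set_def)
      show "length l' = m - 1" using distinct_card[OF *(1)] *(2) X by simp
      show "set (a # take i l') \<subseteq> I" "set (drop i l') \<subseteq> I"
        using * X set_take_subset[of i l'] set_drop_subset[of i l'] by auto
      show "distinct (drop i l')" using * by simp
      have "set (take i l') \<inter> set (drop i l') = {}"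
        using *(1) by (metis append_take_drop_id distinct_append)
      then show "set (a # take i l') \<inter> set (drop i l') = {}"
        using *(2) set_drop_subset[of i l'] by auto
    qed
    have "of_nat (fact m) * ?G l = (\<Sum>l'\<in>permutations_of_set X. ?G l)"
      using X by simp
    also have "\<dots> = (\<Sum>l'\<in>permutations_of_set X. ?G l')"
    proof (rule sum.cong)
      fix l' assume "l' \<in> permutations_of_set X"
      then have "distinct l'" "set l' = X" by (auto simp: permutations_of_set_def)
      then show "?G l = ?G l'"
        using less.prems X by (intro nn_integral_cone_exp_length) (auto simp: m_def dest: distinct_card)
    qed simp
    also have "\<dots> = (\<integral>\<^sup>+\<omega>. (\<Sum>l'\<in>permutations_of_set X. cone_exp \<kappa> (\<lambda>i. \<xi> i \<omega>) l') \<partial>M)"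
      using X by (intro nn_integral_sum[symmetric] meas) (auto simp: permutations_of_set_def)
    also have "\<dots> \<le> (\<integral>\<^sup>+\<omega>. (\<Sum>l'\<in>permutations_of_set (X - {a}). \<Sum>i<m.
        block_exp \<kappa> (\<lambda>i. \<xi> i \<omega>) (set (a # take i l')) * cone_exp \<kappa> (\<lambda>i. \<xi> i \<omega>) (drop i l')) \<partial>M)"
    proof (rule nn_integral_mono_AE, rule AE_mp[OF AE_generic], intro AE_I2 impI)
      fix \<omega> assume "generic_on (\<lambda>i. \<xi> i \<omega>) I"
      then have "generic_on (\<lambda>i. \<xi> i \<omega>) X" using X(4) unfolding generic_on_def by blast
      from sum_permutations_cone_exp_le[OF this X(1,2) \<kappa>]
      show "(\<Sum>l'\<in>permutations_of_set X. cone_exp \<kappa> (\<lambda>i. \<xi> i \<omega>) l')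
        \<le> (\<Sum>l'\<in>permutations_of_set (X - {a}). \<Sum>i<m.
          block_exp \<kappa> (\<lambda>i. \<xi> i \<omega>) (set (a # take i l')) * cone_exp \<kappa> (\<lambda>i. \<xi> i \<omega>) (drop i l'))"
        unfolding X(3) .
    qed
    also have "\<dots> = (\<Sum>l'\<in>permutations_of_set (X - {a}). \<integral>\<^sup>+\<omega>. (\<Sum>i<m.
        block_exp \<kappa> (\<lambda>i. \<xi> i \<omega>) (set (a # take i l')) * cone_exp \<kappa> (\<lambda>i. \<xi> i \<omega>) (drop i l')) \<partial>M)"
      using perm by (intro nn_integral_sum borel_measurable_sum borel_measurable_times_ennreal meas meas_block)
    also have "\<dots> = (\<Sum>l'\<in>permutations_of_set (X - {a}). \<Sum>i<m. \<integral>\<^sup>+\<omega>.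
        block_exp \<kappa> (\<lambda>i. \<xi> i \<omega>) (set (a # take i l')) * cone_exp \<kappa> (\<lambda>i. \<xi> i \<omega>) (drop i l') \<partial>M)"
      using perm by (intro sum.cong nn_integral_sum borel_measurable_times_ennreal meas meas_block refl)
    also have "\<dots> \<le> (\<Sum>l'\<in>permutations_of_set (X - {a}). \<Sum>i<m. ennreal (s * growth s (m - Suc i)))"
    proof (intro sum_mono)
      fix l' i assume l': "l' \<in> permutations_of_set (X - {a})" and i: "i \<in> {..<m}"
      have "(\<integral>\<^sup>+\<omega>. block_exp \<kappa> (\<lambda>i. \<xi> i \<omega>) (set (a # take i l')) * cone_exp \<kappa> (\<lambda>i. \<xi> i \<omega>) (drop i l') \<partial>M)
          = ennreal s * ?G (drop i l')"
        unfolding \<kappa>_def using s perm(4-7)[OF l', of i] by (intro nn_integral_block_exp_cone_exp) auto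
      also have "?G (drop i l') \<le> ennreal (growth s (length (drop i l')))"
        using perm(1-3)[OF l'] perm(4-7)[OF l', of i] X(5) by (intro less.hyps) (auto simp: m_def[symmetric])
      also have "length (drop i l') = m - Suc i" using perm(3)[OF l'] by simp
      finally show "(\<integral>\<^sup>+\<omega>. block_exp \<kappa> (\<lambda>i. \<xi> i \<omega>) (set (a # take i l')) *
          cone_exp \<kappa> (\<lambda>i. \<xi> i \<omega>) (drop i l') \<partial>M) \<le> ennreal (s * growth s (m - Suc i))"
        using s by (simp add: ennreal_mult growth_nonneg mult_left_mono)
    qed
    also have "\<dots> = of_nat (fact (m - 1)) * ennreal (\<Sum>i<m. s * growth s (m - Suc i))"
      using X s by (simp add: sum_ennreal growth_nonneg)
    also have "(\<Sum>i<m. s * growth s (m - Suc i)) = s * (\<Sum>i<m. growth s i)"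
      by (simp only: sum.nat_diff_reindex sum_distrib_left[symmetric])
    also have "\<dots> = real m * growth s m" by (rule sum_growth)
    also have "of_nat (fact (m - 1)) * ennreal (real m * growth s m) = of_nat (fact m) * ennreal (growth s m)"
    proof -
      have "fact m = real m * fact (m - 1)" using X(5) by (simp add: fact_reduce)
      then show ?thesis
        using s by (simp add: ennreal_of_nat_eq_real_of_nat ennreal_mult[symmetric] growth_nonneg mult_ac)
    qed
    finally show ?thesis
      by (subst (asm) ennreal_mult_le_mult_iff) (auto simp: m_def)
  qed
qed

end

section \<open>Tail bound for products of monotone cones\<close>

context iid_normal
begin

text \<open>Markov's inequality for the product of the independent factors \<open>cone_exp\<close>.
  Since these are suprema, one event serves all \<theta> at once, including a \<theta> that depends
  on the noise.\<close>

lemma gain_tail_bound: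
  assumes s: "s > 1"
    and L: "finite L" "disjoint_family_on set L" "\<And>l. l \<in> L \<Longrightarrow> distinct l \<and> set l \<subseteq> I"
    and bound: "(\<Prod>l\<in>L. growth s (length l)) \<le> exp ((1 - 1 / s\<^sup>2) / (2 * \<sigma>\<^sup>2) * r - p)"
  shows "\<exists>A\<in>sets M. prob A \<ge> 1 - exp (- p) \<and>
    (\<forall>\<omega>\<in>A. \<forall>\<theta>. (\<forall>l\<in>L. sorted (map \<theta> l)) \<longrightarrow> gain (\<lambda>i. \<xi> i \<omega>) \<theta> (\<Union>l\<in>L. set l) \<le> r)"
proof -
  define \<kappa> where "\<kappa> = (1 - 1 / s\<^sup>2) / (2 * \<sigma>\<^sup>2)"
  have \<kappa>: "\<kappa> > 0" using s sigma_pos by (simp add: \<kappa>_def one_less_power)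
  define u where "u \<omega> = (\<Prod>l\<in>L. cone_exp \<kappa> (\<lambda>i. \<xi> i \<omega>) l)" for \<omega>
  have meas: "(\<lambda>\<omega>. cone_exp \<kappa> (\<lambda>i. \<xi> i \<omega>) l) \<in> borel_measurable M" if "l \<in> L" for l
    using L(3)[OF that] by (intro cone_exp_measurable) auto
  have u [measurable]: "u \<in> borel_measurable M"
    unfolding u_def by (intro borel_measurable_prod_ennreal meas)
  have "(\<integral>\<^sup>+\<omega>. u \<omega> \<partial>M) = (\<Prod>l\<in>L. \<integral>\<^sup>+\<omega>. cone_exp \<kappa> (\<lambda>i. \<xi> i \<omega>) l \<partial>M)"
    unfolding u_def
  proof (rule nn_integral_prod_disjoint[OF L(1,2)])
    show "(\<lambda>x. cone_exp \<kappa> x l) \<in> borel_measurable (PiM (set l) (\<lambda>_. borel))" for l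
      by (rule cone_exp_measurable[where X = "\<lambda>i y. y i"]) simp
    show "cone_exp \<kappa> (\<lambda>i. \<xi> i \<omega>) l = cone_exp \<kappa> (\<lambda>i\<in>set l. \<xi> i \<omega>) l" for l \<omega>
      by (rule cone_exp_cong) simp
  qed (use L(3) in auto)
  also have "\<dots> \<le> (\<Prod>l\<in>L. ennreal (growth s (length l)))"
    unfolding \<kappa>_def using s L(3) by (intro prod_mono_ennreal nn_integral_cone_exp_le) auto
  also have "\<dots> = ennreal (\<Prod>l\<in>L. growth s (length l))"
    using s by (simp add: prod_ennreal growth_nonneg)
  also have "\<dots> \<le> ennreal (exp (\<kappa> * r - p))" using bound by (intro ennreal_leI) (simp add: \<kappa>_def)
  finally have int: "(\<integral>\<^sup>+\<omega>. u \<omega> \<partial>M) \<le> ennreal (exp (\<kappa> * r - p))" .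
  define c where "c = ennreal (exp (- (\<kappa> * r)))"
  define B where "B = {\<omega> \<in> space M. 1 \<le> c * u \<omega>}"
  have B [measurable]: "B \<in> sets M" unfolding B_def by measurable
  have "emeasure M B \<le> c * (\<integral>\<^sup>+\<omega>. u \<omega> * indicator (space M) \<omega> \<partial>M)"
    unfolding B_def by (rule nn_integral_Markov_inequality) measurable
  also have "(\<integral>\<^sup>+\<omega>. u \<omega> * indicator (space M) \<omega> \<partial>M) = (\<integral>\<^sup>+\<omega>. u \<omega> \<partial>M)"
    by (rule nn_integral_cong) simp
  also have "c * (\<integral>\<^sup>+\<omega>. u \<omega> \<partial>M) \<le> c * ennreal (exp (\<kappa> * r - p))" by (intro mult_left_mono int) simp
  also have "\<dots> = ennreal (exp (- p))"
    unfolding c_def by (simp add: ennreal_mult[symmetric] exp_add[symmetric])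
  finally have "prob B \<le> exp (- p)" by (simp add: emeasure_eq_measure)
  then have "prob (space M - B) \<ge> 1 - exp (- p)" by (simp add: prob_compl)
  moreover have "gain (\<lambda>i. \<xi> i \<omega>) \<theta> (\<Union>l\<in>L. set l) \<le> r"
    if \<omega>: "\<omega> \<in> space M - B" and \<theta>: "\<forall>l\<in>L. sorted (map \<theta> l)" for \<omega> \<theta>
  proof -
    let ?g = "gain (\<lambda>i. \<xi> i \<omega>) \<theta>"
    have "?g (\<Union>l\<in>L. set l) = (\<Sum>l\<in>L. ?g (set l))"
      unfolding gain_def using L(1,2) by (intro sum.UNION_disjoint) (auto simp: disjoint_family_on_def)
    then have "ennreal (exp (\<kappa> * ?g (\<Union>l\<in>L. set l))) = (\<Prod>l\<in>L. ennreal (exp (\<kappa> * ?g (set l))))"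
      using L(1) by (simp add: sum_distrib_left exp_sum prod_ennreal)
    also have "\<dots> \<le> u \<omega>"
      unfolding u_def cone_exp_def using \<theta> by (intro prod_mono_ennreal SUP_upper) auto
    finally have "c * ennreal (exp (\<kappa> * ?g (\<Union>l\<in>L. set l))) \<le> c * u \<omega>" by (intro mult_left_mono) auto
    also have "\<dots> < 1" using \<omega> by (auto simp: B_def)
    finally have "exp (\<kappa> * (?g (\<Union>l\<in>L. set l) - r)) < 1"
      by (simp add: c_def ennreal_mult[symmetric] exp_add[symmetric] right_diff_distrib)
    then show ?thesis using \<kappa> by (simp add: mult_less_0_iff)
  qed
  ultimately show ?thesis by (intro bexI[of _ "space M - B"]) auto
qed

end

section \<open>Unimodal least squares\<close>

text \<open>With \<open>b = sqrt a\<close> one has \<open>T = b * (s - 1)\<close>, and the level is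
  the square of \<open>\<sigma> * b * s\<close>. The claim becomes
  \<open>(s^2 - 1) - (s - 1)^2 = 2 * (s - 1)\<close>, scaled by \<open>b^2 / 2\<close>.\<close>

lemma chernoff_exponent:
  fixes a T \<sigma> :: real
  assumes "a > 0" "T > 0" "\<sigma> > 0"
  defines "s \<equiv> 1 + T / sqrt a"
  shows "(1 - 1 / s\<^sup>2) / (2 * \<sigma>\<^sup>2) * (\<sigma> * (sqrt a + T))\<^sup>2 - T\<^sup>2 / 2 = (s - 1) * a"
proof -
  define b where "b = sqrt a"
  have b: "b > 0" "a = b\<^sup>2" using assms by (auto simp: b_def)
  have s: "s > 0" "T = b * (s - 1)" using assms(2) b(1) by (simp_all add: s_def b_def[symmetric] add_pos_pos)
  have "(\<sigma> * (sqrt a + T))\<^sup>2 = \<sigma>\<^sup>2 * b\<^sup>2 * s\<^sup>2"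
    unfolding b_def[symmetric] s(2) by (simp add: power2_eq_square algebra_simps)
  then have "(1 - 1 / s\<^sup>2) / (2 * \<sigma>\<^sup>2) * (\<sigma> * (sqrt a + T))\<^sup>2 = (s\<^sup>2 - 1) * b\<^sup>2 / 2"
    using s(1) assms(3) by (simp add: field_simps)
  then show ?thesis unfolding s(2) b(2) by (simp add: power2_eq_square field_simps)
qed

text \<open>Concavity: the logarithm lies below its tangent at \<open>n / K\<close>. Replacing
  \<open>card L\<close> by \<open>K\<close> uses \<open>K \<le> n\<close>, which makes
  \<open>ln (n / K)\<close> nonnegative.\<close>

lemma sum_ln_length_le:
  assumes "finite L" "(\<Sum>l\<in>L. length l) = n" "\<And>l. l \<in> L \<Longrightarrow> l \<noteq> []" "card L \<le> K" "K \<le> n" "K > 0"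
  shows "(\<Sum>l\<in>L. 1 + ln (real (length l))) \<le> real K * ln (exp 1 * real n / real K)"
proof -
  have pos: "real n > 0" "real K > 0" using assms by auto
  have "ln (real (length l)) \<le> real (length l) * (real K / real n) - 1 + ln (real n / real K)" if "l \<in> L" for l
  proof -
    have l: "real (length l) > 0" using assms(3)[OF that] by simp
    have "ln (real (length l) * (real K / real n)) \<le> real (length l) * (real K / real n) - 1"
      using l pos by (intro ln_le_minus_one) auto
    then show ?thesis using l pos by (simp add: ln_mult ln_div)
  qed
  then have "(\<Sum>l\<in>L. 1 + ln (real (length l))) \<le> (\<Sum>l\<in>L. real (length l) * (real K / real n) + ln (real n / real K))"
    by (intro sum_mono) fastforce
  also have "\<dots> = real n * (real K / real n) + real (card L) * ln (real n / real K)"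
    using assms(2) by (simp only: sum.distrib sum_distrib_right[symmetric] of_nat_sum[symmetric] sum_constant)
  also have "\<dots> \<le> real K + real K * ln (real n / real K)"
    using pos assms by (intro add_mono mult_right_mono) auto
  also have "\<dots> = real K * ln (exp 1 * real n / real K)"
    using pos by (simp add: ln_mult ln_div algebra_simps)
  finally show ?thesis .
qed

section \<open>Unimodal sequences and the constant pieces of the mean\<close>

lemma unimodal_cone_mono:
  assumes "v \<in> unimodal_cone n m" "m \<le> i" "i \<le> j" "j \<le> n"
  shows "v i \<le> v j"
  using assms(3,4)
proof (induction j rule: dec_induct)
  case (step j)
  then have "v j \<le> v (j + 1)" using assms(1,2) by (auto simp: unimodal_cone_def)
  with step show ?case by simp
qed simp

lemma unimodal_cone_antimono:
  assumes "v \<in> unimodal_cone n m" "1 \<le> i" "i \<le> j" "j \<le> m"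
  shows "v j \<le> v i"
  using assms(3,4)
proof (induction j rule: dec_induct)
  case (step j)
  then have "v (j + 1) \<le> v j" using assms(1,2) by (auto simp: unimodal_cone_def)
  with step show ?case by simp
qed simp

definition constant_pieces :: "nat \<Rightarrow> (nat \<Rightarrow> real) \<Rightarrow> nat set set \<Rightarrow> bool" where
  "constant_pieces n u P \<longleftrightarrow> partition_on {1..n} P \<and>
     (\<forall>I\<in>P. (\<exists>a b. I = {a..b}) \<and> (\<forall>i\<in>I. \<forall>j\<in>I. u i = u j))"

lemma constant_pieces_singletons: "constant_pieces n u ((\<lambda>i. {i}) ` {1..n})"
proof -
  have "\<exists>a b. {i} = {a..b}" for i :: nat by (rule exI[of _ i], rule exI[of _ i]) simp
  then show ?thesis by (auto simp: constant_pieces_def partition_on_def disjoint_def)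
qed

lemma num_pieces_eq: "num_pieces n u = (LEAST k. \<exists>P. constant_pieces n u P \<and> card P = k)"
  unfolding num_pieces_def constant_pieces_def by (rule arg_cong[of _ _ Least]) auto

lemma num_pieces_attained: "\<exists>P. constant_pieces n u P \<and> card P = num_pieces n u"
  unfolding num_pieces_eq by (rule LeastI_ex) (use constant_pieces_singletons in blast)

lemma num_pieces_le: "num_pieces n u \<le> n"
proof -
  have "num_pieces n u \<le> card ((\<lambda>i. {i}) ` {1..n})"
    unfolding num_pieces_eq by (rule Least_le) (use constant_pieces_singletons in blast)
  also have "\<dots> \<le> n" using card_image_le[of "{1..n}" "\<lambda>i. {i}"] by simp
  finally show ?thesis .
qed

text \<open>Splitting the piece of \<open>\<mu>\<close> that contains the mode \<open>m\<close>, and listing the indices of the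
  pieces left of \<open>m\<close> in reverse order, makes \<open>v - \<mu>\<close> increasing along each list.\<close>
lemma unimodal_cone_pieces:
  assumes P: "constant_pieces n \<mu> P" and m: "m \<in> {1..n}"
  shows "\<exists>L. finite L \<and> disjoint_family_on set L \<and> (\<forall>l\<in>L. distinct l \<and> l \<noteq> []) \<and>
    (\<Union>l\<in>L. set l) = {1..n} \<and> card L \<le> card P + 1 \<and>
    (\<forall>v\<in>unimodal_cone n m. \<forall>l\<in>L. sorted (map (\<lambda>i. v i - \<mu> i) l))"
proof -
  have part: "partition_on {1..n} P" using P by (simp add: constant_pieces_def)
  note pieces = bspec[OF conjunct2[OF P[unfolded constant_pieces_def]]]
  note interval = pieces[THEN conjunct1] and const_on = pieces[THEN conjunct2]
  have fin: "finite P" using part finite_elements by blast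
  have sub: "I \<subseteq> {1..n}" if "I \<in> P" for I using that part partition_onD1 by blast
  have uniq: "I = I'" if "I \<in> P" "I' \<in> P" "i \<in> I" "i \<in> I'" for I I' i
    using part that unfolding partition_on_def disjoint_def by blast
  define J where "J = ((\<lambda>I. I \<inter> {..m}) ` P \<union> (\<lambda>I. I \<inter> {m<..}) ` P) - {{}}"
  have finJ: "finite J" using fin by (simp add: J_def)
  have mem: "\<exists>I\<in>P. A \<subseteq> I \<and> (A \<subseteq> {..m} \<or> A \<subseteq> {m<..})" if "A \<in> J" for A
    using that unfolding J_def by auto
  have fin': "finite A" if "A \<in> J" for A
    using mem[OF that] sub by (meson finite_atLeastAtMost finite_subset)
  have disj: "A \<inter> B = {}" if AB: "A \<in> J" "B \<in> J" "A \<noteq> B" for A B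
  proof (rule ccontr)
    assume "A \<inter> B \<noteq> {}"
    then obtain i where i: "i \<in> A" "i \<in> B" by auto
    have *: "\<exists>I\<in>P. i \<in> I \<and> C = (if i \<le> m then I \<inter> {..m} else I \<inter> {m<..})" if "C \<in> J" "i \<in> C" for C
    proof -
      obtain I where "I \<in> P" "C = I \<inter> {..m} \<or> C = I \<inter> {m<..}" using \<open>C \<in> J\<close> unfolding J_def by blast
      with \<open>i \<in> C\<close> show ?thesis by (intro bexI[of _ I]) auto
    qed
    from *[OF AB(1) i(1)] *[OF AB(2) i(2)] obtain I I' where I: "I \<in> P" "I' \<in> P" "i \<in> I" "i \<in> I'"
      "A = (if i \<le> m then I \<inter> {..m} else I \<inter> {m<..})" "B = (if i \<le> m then I' \<inter> {..m} else I' \<inter> {m<..})"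
      by blast
    then have "I = I'" using uniq by blast
    then show False using I(5,6) AB(3) by blast
  qed
  have union: "\<Union>J = {1..n}"
  proof -
    have "i \<in> \<Union>J" if "i \<in> I" "I \<in> P" for i I
    proof (cases "i \<le> m")
      case True
      then have "i \<in> I \<inter> {..m}" "I \<inter> {..m} \<in> J" using that unfolding J_def by auto
      then show ?thesis by blast
    next
      case False
      then have "i \<in> I \<inter> {m<..}" "I \<inter> {m<..} \<in> J" using that unfolding J_def by auto
      then show ?thesis by blast
    qed
    moreover have "\<Union>J \<subseteq> \<Union>P" using mem by blast
    ultimately have "\<Union>J = \<Union>P" by blast
    then show ?thesis using part partition_onD1 by metis
  qed
  define g where "g A = (if A \<subseteq> {..m} then rev (sorted_list_of_set A) else sorted_list_of_set A)" for A :: "nat set"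
  have set_g: "set (g A) = A" "distinct (g A)" if "A \<in> J" for A
    using fin'[OF that] by (simp_all add: g_def)
  have "card (g ` J) \<le> card J" by (rule card_image_le[OF finJ])
  also have "card J \<le> card P + 1"
  proof -
    obtain I0 where I0: "I0 \<in> P" "m \<in> I0" using m part partition_onD1 by blast
    \<comment> \<open>Only the piece \<open>I0\<close> containing the mode is cut in two: an
      interval avoiding \<open>m\<close> lies on one side of it.\<close>
    have "J \<subseteq> (P - {I0}) \<union> {I0 \<inter> {..m}, I0 \<inter> {m<..}}"
    proof
      fix A assume A: "A \<in> J"
      then obtain I where I: "I \<in> P" "A = I \<inter> {..m} \<or> A = I \<inter> {m<..}" and ne: "A \<noteq> {}" unfolding J_def by auto
      show "A \<in> (P - {I0}) \<union> {I0 \<inter> {..m}, I0 \<inter> {m<..}}"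
      proof (cases "I = I0")
        case False
        then have "m \<notin> I" using uniq I0 I by blast
        obtain a b where "I = {a..b}" using interval[OF I(1)] by blast
        with \<open>m \<notin> I\<close> have "I \<subseteq> {..m} \<or> I \<subseteq> {m<..}" by (cases "m < a") auto
        moreover have "{..m} \<inter> {m<..} = {}" by auto
        ultimately have "A = I" using I(2) ne by blast
        with False I show ?thesis by simp
      qed (use I in auto)
    qed
    then have "card J \<le> card ((P - {I0}) \<union> {I0 \<inter> {..m}, I0 \<inter> {m<..}})"
      using fin by (intro card_mono) auto
    also have "\<dots> \<le> card (P - {I0}) + card {I0 \<inter> {..m}, I0 \<inter> {m<..}}" by (rule card_Un_le)
    also have "\<dots> \<le> (card P - 1) + 2"
      using fin I0 card_insert_le_m1[of 2 "{I0 \<inter> {m<..}}" "I0 \<inter> {..m}"] by (intro add_mono) auto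
    also have "\<dots> = card P + 1" using fin I0 card_gt_0_iff[of P] by auto
    finally show ?thesis .
  qed
  finally have card: "card (g ` J) \<le> card P + 1" .
  have "sorted (map (\<lambda>i. v i - \<mu> i) (g A))" if v: "v \<in> unimodal_cone n m" and A: "A \<in> J" for v A
  proof -
    obtain I where I: "I \<in> P" "A \<subseteq> I" "A \<subseteq> {..m} \<or> A \<subseteq> {m<..}" using mem[OF A] by blast
    have const: "\<mu> i = \<mu> j" if "i \<in> A" "j \<in> A" for i j
      using const_on[OF I(1)] I(2) that by blast
    have range: "1 \<le> i \<and> i \<le> n" if "i \<in> A" for i using sub[OF I(1)] I(2) that by auto
    have ord: "sorted_wrt (<) (sorted_list_of_set A)" by simp
    have mems: "set (sorted_list_of_set A) = A" using fin'[OF A] by simp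
    show ?thesis
    proof (cases "A \<subseteq> {..m}")
      case True
      have "sorted_wrt (\<lambda>i j. v j - \<mu> j \<le> v i - \<mu> i) (sorted_list_of_set A)"
      proof (rule sorted_wrt_mono_rel[OF _ ord])
        fix i j assume "i \<in> set (sorted_list_of_set A)" "j \<in> set (sorted_list_of_set A)" "i < j"
        then show "v j - \<mu> j \<le> v i - \<mu> i"
          using unimodal_cone_antimono[OF v, of i j] const[of i j] range[of i] True unfolding mems by auto
      qed
      then show ?thesis using True by (simp add: g_def sorted_wrt_map sorted_wrt_rev)
    next
      case False
      then have Am: "A \<subseteq> {m<..}" using I by blast
      have "sorted_wrt (\<lambda>i j. v i - \<mu> i \<le> v j - \<mu> j) (sorted_list_of_set A)"
      proof (rule sorted_wrt_mono_rel[OF _ ord])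
        fix i j assume "i \<in> set (sorted_list_of_set A)" "j \<in> set (sorted_list_of_set A)" "i < j"
        then show "v i - \<mu> i \<le> v j - \<mu> j"
          using unimodal_cone_mono[OF v, of i j] const[of i j] range[of j] Am unfolding mems by fastforce
      qed
      then show ?thesis using False by (simp add: g_def sorted_wrt_map)
    qed
  qed
  moreover have "disjoint_family_on set (g ` J)"
    unfolding disjoint_family_on_def using disj set_g by (metis (no_types, lifting) imageE)
  moreover have "\<forall>l\<in>g ` J. distinct l \<and> l \<noteq> []"
    using set_g unfolding J_def by (metis (no_types, lifting) DiffD2 imageE insertI1 list.set(1))
  moreover have "(\<Union>l\<in>g ` J. set l) = {1..n}" using union set_g by auto
  ultimately show ?thesis using finJ card by (intro exI[of _ "g ` J"]) auto
qed

text \<open>Comparing \<open>v\<close> with \<open>\<mu>\<close> gives \<open>\<Sum>h\<^sup>2 \<le> 2 \<Sum>z h\<close> for \<open>h = v - \<mu>\<close>, so the gain at \<open>h / 2\<close> is at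
  least \<open>\<Sum>h\<^sup>2 / 4\<close>.\<close>
lemma least_squares_error_le:
  assumes n: "n \<ge> 1" and ls: "is_least_squares n K (\<lambda>i. \<mu> i + z i) v" and "\<mu> \<in> K"
    and gain: "gain z (\<lambda>i. (v i - \<mu> i) / 2) {1..n} \<le> R\<^sup>2" and R: "R \<ge> 0"
  shows "scaled_norm n (\<lambda>i. v i - \<mu> i) \<le> 2 / sqrt (real n) * R"
proof -
  define h where "h i = v i - \<mu> i" for i
  have sq: "(scaled_norm n w)\<^sup>2 = (\<Sum>i=1..n. (w i)\<^sup>2) / real n" for w
    unfolding scaled_norm_def by (simp add: sum_nonneg)
  have "(scaled_norm n (\<lambda>i. \<mu> i + z i - v i))\<^sup>2 \<le> (scaled_norm n (\<lambda>i. \<mu> i + z i - \<mu> i))\<^sup>2"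
    using ls \<open>\<mu> \<in> K\<close> unfolding is_least_squares_def is_arg_min_def by (auto simp: not_less)
  then have "(\<Sum>i=1..n. (\<mu> i + z i - v i)\<^sup>2) \<le> (\<Sum>i=1..n. (z i)\<^sup>2)"
    using n unfolding sq by (simp add: divide_le_cancel)
  also have "(\<Sum>i=1..n. (\<mu> i + z i - v i)\<^sup>2) = (\<Sum>i=1..n. (z i)\<^sup>2 - 2 * (z i * h i) + (h i)\<^sup>2)"
    by (rule sum.cong) (simp_all add: h_def power2_eq_square algebra_simps)
  finally have basic: "(\<Sum>i=1..n. (h i)\<^sup>2) \<le> 2 * (\<Sum>i=1..n. z i * h i)"
    by (simp add: sum.distrib sum_subtractf sum_distrib_left)
  have "gain z (\<lambda>i. h i / 2) {1..n} = (\<Sum>i=1..n. z i * h i) - (\<Sum>i=1..n. (h i)\<^sup>2) / 4"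
    unfolding gain_def by (simp add: sum_subtractf sum_divide_distrib power_divide)
  with gain basic have "(\<Sum>i=1..n. (h i)\<^sup>2) \<le> (2 * R)\<^sup>2"
    unfolding h_def by (simp add: power_mult_distrib)
  then have "scaled_norm n h \<le> sqrt ((1 / real n) * (2 * R)\<^sup>2)"
    unfolding scaled_norm_def by (intro real_sqrt_le_mono mult_left_mono) auto
  also have "\<dots> = 2 / sqrt (real n) * R"
    using R by (simp add: real_sqrt_mult real_sqrt_divide)
  finally show ?thesis by (simp add: h_def[abs_def])
qed

lemma (in prob_space) prob_INT_ge:
  assumes S: "finite S" "S \<noteq> {}" and A: "\<And>i. i \<in> S \<Longrightarrow> A i \<in> events" "\<And>i. i \<in> S \<Longrightarrow> prob (A i) \<ge> 1 - p"
  shows "prob (\<Inter>i\<in>S. A i) \<ge> 1 - real (card S) * p"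
proof -
  have ev: "(\<Inter>i\<in>S. A i) \<in> events" using S A(1) by (intro sets.finite_INT) auto
  have "1 - prob (\<Inter>i\<in>S. A i) = prob (space M - (\<Inter>i\<in>S. A i))" using ev by (simp add: prob_compl)
  also have "space M - (\<Inter>i\<in>S. A i) = (\<Union>i\<in>S. space M - A i)" by auto
  also have "prob \<dots> \<le> (\<Sum>i\<in>S. prob (space M - A i))"
    using S A(1) by (intro finite_measure_subadditive_finite) auto
  also have "\<dots> \<le> (\<Sum>i\<in>S. p)" using A by (intro sum_mono) (fastforce simp: prob_compl)
  finally show ?thesis by simp
qed

lemma prod_growth_le_exp:
  assumes "s \<ge> 1" "finite L" "\<And>l. l \<in> L \<Longrightarrow> l \<noteq> []"
  shows "(\<Prod>l\<in>L. growth s (length l)) \<le> exp ((s - 1) * (\<Sum>l\<in>L. 1 + ln (real (length l))))"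
proof -
  have "growth s (length l) \<le> exp ((s - 1) * (1 + ln (real (length l))))" if "l \<in> L" for l
    using assms(1) assms(3)[OF that] by (intro growth_le_exp) (auto simp: Suc_le_eq)
  then have "(\<Prod>l\<in>L. growth s (length l)) \<le> (\<Prod>l\<in>L. exp ((s - 1) * (1 + ln (real (length l)))))"
    using assms(1) by (intro prod_mono) (auto simp: growth_nonneg)
  also have "\<dots> = exp ((s - 1) * (\<Sum>l\<in>L. 1 + ln (real (length l))))"
    using assms(2) by (simp only: exp_sum sum_distrib_left)
  finally show ?thesis .
qed

context iid_normal
begin

text \<open>Lists of length one impose no order, so this bounds the gain over the whole space, with
  growth factor \<open>s\<close> per coordinate.\<close>

lemma gain_tail_bound_singletons:
  assumes s: "s > 1" and bound: "s ^ card I \<le> exp ((1 - 1 / s\<^sup>2) / (2 * \<sigma>\<^sup>2) * r - p)"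
  shows "\<exists>A\<in>sets M. prob A \<ge> 1 - exp (- p) \<and> (\<forall>\<omega>\<in>A. \<forall>\<theta>. gain (\<lambda>i. \<xi> i \<omega>) \<theta> I \<le> r)"
proof -
  have "(\<Prod>l\<in>(\<lambda>i. [i]) ` I. growth s (length l)) = s ^ card I"
    by (subst prod.reindex) (auto simp: inj_on_def growth_def)
  then have "\<exists>A\<in>sets M. prob A \<ge> 1 - exp (- p) \<and> (\<forall>\<omega>\<in>A. \<forall>\<theta>. (\<forall>l\<in>(\<lambda>i. [i]) ` I. sorted (map \<theta> l)) \<longrightarrow>
      gain (\<lambda>i. \<xi> i \<omega>) \<theta> (\<Union>l\<in>(\<lambda>i. [i]) ` I. set l) \<le> r)"
    using bound finite_I by (intro gain_tail_bound[OF s]) (auto simp: disjoint_family_on_def)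
  then show ?thesis by simp
qed

end

text \<open>If every entry of \<open>\<mu>\<close> is a piece of its own then \<open>(n + 1) ln (e n / (n + 1))\<close> falls just short
  of the dimension \<open>n\<close>. There is then a single cone, and the unused \<open>ln n\<close> of the union bound
  makes up for the deficit.\<close>
lemma full_pieces_exponent:
  fixes n :: nat and s :: real
  assumes n: "n \<ge> 2" and s: "s \<ge> 1"
  defines "a \<equiv> real (n + 1) * ln (exp 1 * real n / real (n + 1))"
  shows "s ^ n \<le> exp ((s - 1) * a + ln (real n))"
proof -
  have n0: "real n \<ge> 2" using n by simp
  have aeq: "a = real (n + 1) * (1 - ln (1 + 1 / real n))"
  proof -
    have "ln (exp 1 * real n / real (n + 1)) = 1 + ln (real n) - ln (real (n + 1))"
      using n0 by (simp add: ln_mult ln_div)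
    also have "ln (real (n + 1)) = ln (real n) + ln (1 + 1 / real n)"
    proof -
      have "real (n + 1) = real n * (1 + 1 / real n)" using n0 by (simp add: field_simps)
      moreover have "1 + 1 / real n > 0" using n0 by (simp add: add_pos_nonneg)
      ultimately show ?thesis using n0 by (simp only: ln_mult_pos)
    qed
    finally show ?thesis unfolding a_def by simp
  qed
  have "ln (1 + 1 / real n) \<le> 1 / real n" using n0 by (intro ln_add_one_self_le_self) auto
  then have "a \<ge> real (n + 1) * (1 - 1 / real n)" unfolding aeq by (intro mult_left_mono) auto
  also have "real (n + 1) * (1 - 1 / real n) = real n - 1 / real n" using n0 by (simp add: field_simps)
  finally have lower: "real n - a \<le> 1 / real n" by simp
  have "1 / real n \<le> 1 / 2" using n0 by (intro divide_left_mono) auto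
  with lower n0 have a1: "a \<ge> 1" "real n - a \<le> 1 / 2" by linarith+
  have "ln (1 / (1 + 1 / real n)) \<le> 1 / (1 + 1 / real n) - 1"
    using n0 by (intro ln_le_minus_one) (auto simp: add_pos_nonneg)
  then have "ln (1 + 1 / real n) \<ge> 1 / (real n + 1)"
    using n0 by (simp add: ln_div add_pos_nonneg field_simps)
  then have "a \<le> real (n + 1) * (1 - 1 / (real n + 1))" unfolding aeq by (intro mult_left_mono) auto
  also have "\<dots> = real n" using n0 by (simp add: field_simps)
  finally have upper: "a \<le> real n" .
  \<comment> \<open>Splitting \<open>ln s\<close> at \<open>a / n\<close> makes the bound on
    \<open>n * ln s\<close> linear in \<open>s\<close> with slope \<open>a\<close>; the price is
    \<open>(n - a)^2 / a\<close>, at most 1/4.\<close>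
  have "ln (s * (a / real n)) \<le> s * (a / real n) - 1" using s a1 n0 by (intro ln_le_minus_one) auto
  moreover have "ln (real n / a) \<le> real n / a - 1" using a1 n0 by (intro ln_le_minus_one) auto
  moreover have "ln (s * (a / real n)) = ln s - ln (real n / a)" using s a1 n0 by (simp add: ln_mult ln_div)
  ultimately have "ln s \<le> s * (a / real n) - 1 + (real n / a - 1)" by linarith
  then have "real n * ln s \<le> real n * (s * (a / real n) - 1 + (real n / a - 1))" using n0 by (intro mult_left_mono) auto
  also have "\<dots> = (s - 1) * a + (real n - a)\<^sup>2 / a" using a1 n0 by (simp add: field_simps power2_eq_square)
  also have "(real n - a)\<^sup>2 / a \<le> 1 / 4"
  proof -
    have "(real n - a)\<^sup>2 / a \<le> (real n - a)\<^sup>2 / 1" using a1 by (intro divide_left_mono) auto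
    also have "\<dots> \<le> (1 / 2)\<^sup>2" using a1 upper by (simp only: div_by_1, intro power_mono) auto
    finally show ?thesis by (simp add: power2_eq_square)
  qed
  also have "1 / 4 \<le> ln (real n)"
  proof -
    have "(1 / 2 :: real) \<le> ln 2" using ln_le_minus_one[of "1 / 2 :: real"] by (simp add: ln_div)
    also have "\<dots> \<le> ln (real n)" using n0 by simp
    finally show ?thesis by simp
  qed
  finally have "real n * ln s \<le> (s - 1) * a + ln (real n)" by simp
  moreover have "s ^ n = exp (real n * ln s)" using s by (simp add: exp_of_nat_mult)
  ultimately show ?thesis by simp
qed

theorem theoremA1:
  fixes M :: "'a measure" and n k :: nat and \<mu> :: "nat \<Rightarrow> real" and \<sigma> x :: real
    and \<xi> y \<mu>hat :: "'a \<Rightarrow> nat \<Rightarrow> real"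
  assumes "prob_space M"
    and "\<mu> \<in> unimodal n"
    and "k = num_pieces n \<mu>"
    and "\<sigma> > 0"
    and "prob_space.indep_vars M (\<lambda>_. borel) (\<lambda>i \<omega>. \<xi> \<omega> i) {1..n}"
    and "\<And>i. i \<in> {1..n} \<Longrightarrow> distributed M lborel (\<lambda>\<omega>. \<xi> \<omega> i) (normal_density 0 \<sigma>)"
    and "y = (\<lambda>\<omega> i. \<mu> i + \<xi> \<omega> i)"
    and "\<And>\<omega>. \<omega> \<in> space M \<Longrightarrow> is_least_squares n (unimodal n) (y \<omega>) (\<mu>hat \<omega>)"
    and "x > 0"
  shows "holds_with_prob_ge M (1 - exp (- x))
    (\<lambda>\<omega>. scaled_norm n (\<lambda>i. \<mu>hat \<omega> i - \<mu> i)
       \<le> 2 * \<sigma> / sqrt (real n) *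
          (sqrt (real (k + 1) * ln (exp 1 * real n / real (k + 1))) + sqrt (2 * (x + ln (real n)))))"
proof -
  interpret prob_space M by fact
  interpret iid_normal M "\<lambda>i \<omega>. \<xi> \<omega> i" "{1..n}" \<sigma>
    by unfold_locales (use assms in auto)
  have n: "n \<ge> 1" using assms(2) by (auto simp: unimodal_def)
  have kn: "k \<le> n" using num_pieces_le assms(3) by simp
  define a where "a = real (k + 1) * ln (exp 1 * real n / real (k + 1))"
  define T where "T = sqrt (2 * (x + ln (real n)))"
  define s where "s = 1 + T / sqrt a"
  define R where "R = \<sigma> * (sqrt a + T)"
  \<comment> \<open>Keeps the logarithm in \<open>a\<close> positive even for \<open>k = n\<close>,
    since \<open>k + 1 \<le> 2 * n\<close> and e > 2.\<close>
  have "real (k + 1) < exp 1 * real n"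
  proof -
    have "real (k + 1) \<le> 2 * real n" using n kn by simp
    also have "\<dots> < exp 1 * real n"
      using n exp_lower_Taylor_quadratic[of 1] by (intro mult_strict_right_mono) auto
    finally show ?thesis .
  qed
  then have a: "a > 0" unfolding a_def by (intro mult_pos_pos ln_gt_zero) (auto simp: less_divide_eq)
  have lnn: "ln (real n) \<ge> 0" using n by simp
  have T: "T > 0" "T\<^sup>2 / 2 = x + ln (real n)" using assms(9) lnn by (auto simp: T_def)
  have s: "s > 1" using a T by (simp add: s_def)
  have R: "R \<ge> 0" using a T assms(4) by (simp add: R_def)
  have exponent: "(1 - 1 / s\<^sup>2) / (2 * \<sigma>\<^sup>2) * R\<^sup>2 - (x + ln (real n)) = (s - 1) * a"
    using chernoff_exponent[OF a T(1) assms(4)] unfolding s_def R_def T(2) .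
  have ls: "is_least_squares n (unimodal n) (\<lambda>i. \<mu> i + \<xi> \<omega> i) (\<mu>hat \<omega>)" if "\<omega> \<in> space M" for \<omega>
    using assms(8)[OF that] by (simp add: assms(7))
  have suffices: "scaled_norm n (\<lambda>i. \<mu>hat \<omega> i - \<mu> i) \<le> 2 * \<sigma> / sqrt (real n) * (sqrt a + T)"
    if "\<omega> \<in> space M" "gain (\<lambda>i. \<xi> \<omega> i) (\<lambda>i. (\<mu>hat \<omega> i - \<mu> i) / 2) {1..n} \<le> R\<^sup>2" for \<omega>
    using least_squares_error_le[OF n ls[OF that(1)] assms(2) that(2) R] by (simp add: R_def)
  have "\<exists>A\<in>sets M. prob A \<ge> 1 - exp (- x) \<and>
    (\<forall>\<omega>\<in>A. scaled_norm n (\<lambda>i. \<mu>hat \<omega> i - \<mu> i) \<le> 2 * \<sigma> / sqrt (real n) * (sqrt a + T))"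
  proof -
    \<comment> \<open>The entropy bound needs \<open>k + 1 \<le> n\<close>. For \<open>k = n\<close>
      the full space is used instead, and \<open>n = 1\<close> is separate because
      \<open>ln n\<close> then provides no slack.\<close>
    consider "k < n" | "k = n" "n \<ge> 2" | "k = n" "n = 1" using kn n by linarith
    then show ?thesis
    proof cases
      case 1
      obtain P where P: "constant_pieces n \<mu> P" "card P = k"
        using num_pieces_attained assms(3) by blast
      \<comment> \<open>The extra \<open>ln n\<close> in the exponent pays for the union over the
        \<open>n\<close> possible modes.\<close>
      have "\<exists>A\<in>sets M. prob A \<ge> 1 - exp (- (x + ln (real n))) \<and>
        (\<forall>\<omega>\<in>A. \<forall>v\<in>unimodal_cone n m. gain (\<lambda>i. \<xi> \<omega> i) (\<lambda>i. (v i - \<mu> i) / 2) {1..n} \<le> R\<^sup>2)"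
        if m: "m \<in> {1..n}" for m
      proof -
        obtain L where L: "finite L" "disjoint_family_on set L" "\<And>l. l \<in> L \<Longrightarrow> distinct l \<and> l \<noteq> []"
          "(\<Union>l\<in>L. set l) = {1..n}" "card L \<le> k + 1"
          "\<And>v l. v \<in> unimodal_cone n m \<Longrightarrow> l \<in> L \<Longrightarrow> sorted (map (\<lambda>i. v i - \<mu> i) l)"
          using unimodal_cone_pieces[OF P(1) m] unfolding P(2)
          by (elim exE conjE, intro that) auto
        have "(\<Sum>l\<in>L. length l) = (\<Sum>l\<in>L. card (set l))"
          using L(3) by (intro sum.cong) (auto simp: distinct_card)
        also have "\<dots> = card (\<Union>l\<in>L. set l)"
          using L(1,2) by (intro card_UN_disjoint[symmetric]) (auto simp: disjoint_family_on_def)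
        finally have len: "(\<Sum>l\<in>L. length l) = n" using L(4) by simp
        have "(\<Prod>l\<in>L. growth s (length l)) \<le> exp ((s - 1) * (\<Sum>l\<in>L. 1 + ln (real (length l))))"
          using s L(1,3) by (intro prod_growth_le_exp) auto
        also have "\<dots> \<le> exp ((s - 1) * a)"
          using sum_ln_length_le[OF L(1) len _ L(5)] L(3) 1 s unfolding a_def
          by (simp add: mult_left_mono del: of_nat_add of_nat_Suc)
        finally have bound: "(\<Prod>l\<in>L. growth s (length l)) \<le>
            exp ((1 - 1 / s\<^sup>2) / (2 * \<sigma>\<^sup>2) * R\<^sup>2 - (x + ln (real n)))"
          unfolding exponent .
        have sub: "set l \<subseteq> {1..n}" if "l \<in> L" for l using L(4) that by blast
        obtain A where A: "A \<in> sets M" "prob A \<ge> 1 - exp (- (x + ln (real n)))"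
          "\<And>\<omega> \<theta>. \<omega> \<in> A \<Longrightarrow> \<forall>l\<in>L. sorted (map \<theta> l) \<Longrightarrow> gain (\<lambda>i. \<xi> \<omega> i) \<theta> {1..n} \<le> R\<^sup>2"
          using gain_tail_bound[OF s L(1,2) _ bound] L(3) sub unfolding L(4) by blast
        have "sorted (map (\<lambda>i. (v i - \<mu> i) / 2) l)" if "v \<in> unimodal_cone n m" "l \<in> L" for v l
          using L(6)[OF that] unfolding sorted_map by (rule sorted_wrt_mono_rel[rotated]) (simp add: divide_right_mono)
        with A show ?thesis by (intro bexI[of _ A]) auto
      qed
      then obtain A where A: "\<And>m. m \<in> {1..n} \<Longrightarrow> A m \<in> sets M"
        "\<And>m. m \<in> {1..n} \<Longrightarrow> prob (A m) \<ge> 1 - exp (- (x + ln (real n)))"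
        "\<And>m \<omega> v. m \<in> {1..n} \<Longrightarrow> \<omega> \<in> A m \<Longrightarrow> v \<in> unimodal_cone n m \<Longrightarrow>
           gain (\<lambda>i. \<xi> \<omega> i) (\<lambda>i. (v i - \<mu> i) / 2) {1..n} \<le> R\<^sup>2"
        by metis
      have ev: "(\<Inter>m\<in>{1..n}. A m) \<in> sets M" using A(1) n by (intro sets.finite_INT) auto
      have "prob (\<Inter>m\<in>{1..n}. A m) \<ge> 1 - real (card {1..n}) * exp (- (x + ln (real n)))"
        using A(1,2) n by (intro prob_INT_ge) auto
      also have "real (card {1..n}) * exp (- (x + ln (real n))) = exp (- x)"
        using n by (simp add: exp_diff exp_minus exp_add)
      finally have prob: "prob (\<Inter>m\<in>{1..n}. A m) \<ge> 1 - exp (- x)" by simp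
      show ?thesis
      proof (intro bexI[OF _ ev] conjI ballI prob)
        fix \<omega> assume \<omega>: "\<omega> \<in> (\<Inter>m\<in>{1..n}. A m)"
        then have "\<omega> \<in> space M" using ev sets.sets_into_space by blast
        moreover have "\<mu>hat \<omega> \<in> unimodal n"
          using ls[OF \<open>\<omega> \<in> space M\<close>] by (simp add: is_least_squares_def is_arg_min_def)
        then obtain m where "m \<in> {1..n}" "\<mu>hat \<omega> \<in> unimodal_cone n m" by (auto simp: unimodal_def)
        ultimately show "scaled_norm n (\<lambda>i. \<mu>hat \<omega> i - \<mu> i) \<le> 2 * \<sigma> / sqrt (real n) * (sqrt a + T)"
          using A(3) \<omega> by (intro suffices) auto
      qed
    next
      case 2
      have "s ^ n \<le> exp ((s - 1) * a + ln (real n))"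
        using full_pieces_exponent[OF 2(2), of s] s unfolding a_def 2(1) by simp
      then have "s ^ card {1..n} \<le> exp ((1 - 1 / s\<^sup>2) / (2 * \<sigma>\<^sup>2) * R\<^sup>2 - x)"
        unfolding exponent[symmetric] by simp
      from gain_tail_bound_singletons[OF s this] obtain A where A: "A \<in> sets M"
        "prob A \<ge> 1 - exp (- x)" "\<And>\<omega> \<theta>. \<omega> \<in> A \<Longrightarrow> gain (\<lambda>i. \<xi> \<omega> i) \<theta> {1..n} \<le> R\<^sup>2"
        by blast
      then show ?thesis using suffices sets.sets_into_space[OF A(1)] by (intro bexI[OF _ A(1)]) auto
    next
      case 3
      \<comment> \<open>In dimension one the true cone dimension is 1, so
        \<open>chernoff_exponent\<close> is applied with 1 in place of \<open>a\<close>.\<close>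
      define t where "t = 1 + sqrt (2 * x)"
      have t: "t > 1" using assms(9) by (simp add: t_def)
      have "(1 - 1 / t\<^sup>2) / (2 * \<sigma>\<^sup>2) * (\<sigma> * t)\<^sup>2 - x = t - 1"
        using chernoff_exponent[of 1 "sqrt (2 * x)" \<sigma>] assms(4,9) by (simp add: t_def)
      moreover have "t \<le> exp (t - 1)" using exp_ge_add_one_self[of "t - 1"] by simp
      ultimately have "t ^ card {1..n} \<le> exp ((1 - 1 / t\<^sup>2) / (2 * \<sigma>\<^sup>2) * (\<sigma> * t)\<^sup>2 - x)"
        using 3 by simp
      from gain_tail_bound_singletons[OF t this] obtain A where A: "A \<in> sets M"
        "prob A \<ge> 1 - exp (- x)" "\<And>\<omega> \<theta>. \<omega> \<in> A \<Longrightarrow> gain (\<lambda>i. \<xi> \<omega> i) \<theta> {1..n} \<le> (\<sigma> * t)\<^sup>2"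
        by blast
      \<comment> \<open>Here \<open>a = 2 * (1 - ln 2)\<close>, so \<open>ln 2 \<le> 7 / 8\<close>
        gives \<open>sqrt a \<ge> 1 / 2\<close>.\<close>
      have "ln 2 \<le> (7 / 8 :: real)" using ln2_le_25_over_36 by simp
      then have "1 / 4 \<le> a" using 3 by (simp add: a_def ln_div)
      then have "sqrt ((1 / 2)\<^sup>2) \<le> sqrt a" by (intro real_sqrt_le_mono) (simp add: power2_eq_square)
      then have "1 \<le> 2 * sqrt a" by simp
      moreover have "t = 1 + T" using 3 by (simp add: t_def T_def)
      ultimately have tT: "t \<le> 2 * (sqrt a + T)" using T(1) by (simp add: algebra_simps)
      show ?thesis
      proof (intro bexI[OF _ A(1)] conjI ballI A(2))
        fix \<omega> assume \<omega>: "\<omega> \<in> A"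
        then have sp: "\<omega> \<in> space M" using A(1) sets.sets_into_space by blast
        \<comment> \<open>Every sequence is unimodal when \<open>n = 1\<close>, so the estimator
          reproduces the data and the error is the noise itself. The factor 2 lost in the general
          comparison is saved and absorbs \<open>t \<le> 2 * (sqrt a + T)\<close>.\<close>
        have "(\<lambda>i. \<mu> i + \<xi> \<omega> i) \<in> unimodal n" using 3 by (simp add: unimodal_def unimodal_cone_def)
        then have "(scaled_norm n (\<lambda>i. \<mu> i + \<xi> \<omega> i - \<mu>hat \<omega> i))\<^sup>2 \<le> (scaled_norm n (\<lambda>i. 0))\<^sup>2"
          using ls[OF sp] unfolding is_least_squares_def is_arg_min_def by (force simp: not_less)
        then have eq: "\<mu>hat \<omega> 1 - \<mu> 1 = \<xi> \<omega> 1" using 3 by (simp add: scaled_norm_def)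
        have "(\<xi> \<omega> 1)\<^sup>2 \<le> (\<sigma> * t)\<^sup>2"
          using A(3)[OF \<omega>, of "\<xi> \<omega>"] 3 by (simp add: gain_def power2_eq_square)
        then have "\<bar>\<xi> \<omega> 1\<bar> \<le> \<sigma> * t"
          using assms(4) t by (simp add: abs_le_square_iff[symmetric] abs_mult)
        also have "\<dots> \<le> \<sigma> * (2 * (sqrt a + T))"
          using assms(4) tT by (intro mult_left_mono) auto
        finally show "scaled_norm n (\<lambda>i. \<mu>hat \<omega> i - \<mu> i) \<le> 2 * \<sigma> / sqrt (real n) * (sqrt a + T)"
          using 3 eq by (simp add: scaled_norm_def algebra_simps)
      qed
    qed
  qed
  then show ?thesis unfolding holds_with_prob_ge_def a_def T_def .
qed

end
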